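(* Let $\pi$ be a probability distribution on $(\Theta\times\mathsf X,\mathcal B(\Theta)\times\mathcal B(\mathsf X))$ and let $\{\Pi_\theta,\theta\in\Theta\}$ be a family of Markov kernels on $\mathsf X$ such that for any $\theta\in\Theta$, $\Pi_\theta$ is reversible with respect to $\pi_\theta$. Let $\Gamma_x$ and $\Phi_x$ be the Gibbs and Metropolis-within-Gibbs kernels on $\mathsf X$ defined in the context, and define $$\varrho:=\inf_{f\in L^2(\mathsf X,\pi)}\frac{\int_\Theta\pi(d\theta)\,\mathrm{var}_{\pi_\theta}(f)\,\mathrm{Gap}(\Pi_\theta)}{\int_\Theta\pi(d\theta)\,\mathrm{var}_{\pi_\theta}(f)}.$$ Then for any $f\in L^2(\mathsf X,\pi)$: (a) $2\mathcal E_{\Gamma_x}(f)\ge\mathcal E_{\Phi_x}(f)\ge\varrho\,\mathcal E_{\Gamma_x}(f)$; (b) $2\,\mathrm{Gap}(\Gamma_x)\ge\mathrm{Gap}(\Phi_x)\ge\varrho\,\mathrm{Gap}(\Gamma_x)$; (c) $\displaystyle 0\le\frac{\mathrm{var}(f,\Gamma_x)-\mathrm{var}_\pi(f)}2\le\mathrm{var}(f,\Phi_x)\le(\varrho^{-1}-1)\mathrm{var}_\pi(f)+\varrho^{-1}\mathrm{var}(f,\Gamma_x)$, where the last inequality holds for $\varrho>0$; (d) in addition: (i) if there exists $\epsilon>0$ such that for all $\theta\in\Theta$ and all $(x,B)\in\mathsf X\times\mathcal B(\mathsf X)$, $\Pi_\theta(x,B)\ge\epsilon\,\pi_\theta(B)$,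 then for any $f\in L^2(\mathsf X,\pi)$, $\displaystyle\frac{\mathrm{var}(f,\Gamma_x)-(1-\epsilon)\mathrm{var}_\pi(f)}{2-\epsilon}\le\mathrm{var}(f,\Phi_x)$; (ii) if for all $\theta\in\Theta$, $\Pi_\theta$ is a positive operator, then for any $f\in L^2(\mathsf X,\pi)$, $\mathrm{var}(f,\Gamma_x)\le\mathrm{var}(f,\Phi_x)$.
   Context: $\pi_\theta(dx)$ and $\pi_x(d\theta)$ denote the (regular) conditional distributions under $\pi$ of $x$ given $\theta$ and of $\theta$ given $x$; $\pi(d\theta)$ and $\pi(dx)$ denote the marginals of $\pi$. All kernels and functions are measurable in all arguments. For $x\in\mathsf X$, $B\in\mathcal B(\mathsf X)$, $$\Gamma_x(x,B):=\int_\Theta\pi_x(d\vartheta)\,\pi_\vartheta(B),\qquad\Phi_x(x,B):=\int_\Theta\pi_x(d\vartheta)\,\Pi_\vartheta(x,B);$$ the subscript $x$ in the names $\Gamma_x,\Phi_x$ is part of the name, not a variable. These are the $x$-marginal kernels of the two-stage Gibbs sampler $\Gamma(\theta_0,x;S)=\int_S\pi_x(d\vartheta)\pi_\vartheta(dy)$ and of $\Phi(\theta_0,x;S)=\int_S\pi_x(d\vartheta)\Pi_\vartheta(x,dy)$ on $\Theta\times\mathsf X$; both $\Gamma_x,\Phi_x$ are reversible with respect to $\pi(dx)$. $L^2(\mathsf X,\pi)$ is the space of real functions on $\mathsf X$ square integrable under $\pi(dx)$. For a $\mu$-reversible Markov kernel $\Pi$ on $\mathsf E$ and $f\in L^2(\mathsf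 E,\mu)$: $\langle f,g\rangle_\mu=\int fg\,d\mu$, $\mathcal E_\Pi(f):=\langle f,(I-\Pi)f\rangle_\mu$; $L_0^2(\mathsf E,\mu):=\{f\in L^2(\mathsf E,\mu):\mu(f)=0\}$; $\mathrm{Gap}(\Pi):=\inf_{f\in L^2_0(\mathsf E,\mu),f\ne0}\mathcal E_\Pi(f)/\|f\|_\mu^2$; $\mathrm{var}_\mu(f):=\mu(f^2)-\mu(f)^2$; $\mathrm{var}(f,\Pi):=\lim_{M\to\infty}\mathrm{var}(M^{-1/2}\sum_{i=1}^M[f(\xi_i)-\mu(f)])$ for the stationary chain $(\xi_i)$ with kernel $\Pi$ (possibly $+\infty$). $\Pi$ is positive if $\langle f,\Pi f\rangle_\mu\ge0$ for all $f\in L^2(\mathsf E,\mu)$. $\mathrm{Gap}(\Pi_\theta)$ is relative to $\pi_\theta$. The infimum defining $\varrho$ is over $f$ with nonzero denominator. *)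

theory Defs
  imports "HOL-Probability.Probability"
begin

section \<open>Functionals of a reversible kernel\<close>

text \<open>A Markov kernel from \<open>M\<close> to \<open>N\<close> is an element of \<open>M \<rightarrow>\<^sub>M prob_algebra N\<close>. Square-integrable
  functions are actual functions, not classes; ``nonzero in \<open>L\<^sup>2\<close>'' is therefore expressed by a
  nonzero norm.\<close>

definition L2 :: "'a measure \<Rightarrow> ('a \<Rightarrow> real) set" where
  "L2 \<mu> = {f \<in> borel_measurable \<mu>. integrable \<mu> (\<lambda>x. (f x)\<^sup>2)}"

definition L2_inner :: "'a measure \<Rightarrow> ('a \<Rightarrow> real) \<Rightarrow> ('a \<Rightarrow> real) \<Rightarrow> real" where
  "L2_inner \<mu> f g = (\<integral>x. f x * g x \<partial>\<mu>)"

definition L2_zero :: "'a measure \<Rightarrow> ('a \<Rightarrow> real) set" where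
  "L2_zero \<mu> = {f \<in> L2 \<mu>. (\<integral>x. f x \<partial>\<mu>) = 0}"

definition var_wrt :: "'a measure \<Rightarrow> ('a \<Rightarrow> real) \<Rightarrow> real" where
  "var_wrt \<mu> f = (\<integral>x. (f x)\<^sup>2 \<partial>\<mu>) - (\<integral>x. f x \<partial>\<mu>)\<^sup>2"

definition reversible :: "'a measure \<Rightarrow> ('a \<Rightarrow> 'a measure) \<Rightarrow> bool" where
  "reversible \<mu> K \<longleftrightarrow>
     (\<forall>A\<in>sets \<mu>. \<forall>B\<in>sets \<mu>.
        (\<integral>\<^sup>+x\<in>A. emeasure (K x) B \<partial>\<mu>) = (\<integral>\<^sup>+x\<in>B. emeasure (K x) A \<partial>\<mu>))"

definition kernel_op :: "('a \<Rightarrow> 'a measure) \<Rightarrow> ('a \<Rightarrow> real) \<Rightarrow> 'a \<Rightarrow> real" where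
  "kernel_op K f x = (\<integral>y. f y \<partial>K x)"

definition dirichlet :: "'a measure \<Rightarrow> ('a \<Rightarrow> 'a measure) \<Rightarrow> ('a \<Rightarrow> real) \<Rightarrow> real" where
  "dirichlet \<mu> K f = L2_inner \<mu> f (\<lambda>x. f x - kernel_op K f x)"

definition positive_kernel :: "'a measure \<Rightarrow> ('a \<Rightarrow> 'a measure) \<Rightarrow> bool" where
  "positive_kernel \<mu> K \<longleftrightarrow> (\<forall>f\<in>L2 \<mu>. 0 \<le> L2_inner \<mu> f (kernel_op K f))"

text \<open>Extended-real valued, so that the infimum over the empty set (\<open>L2_zero \<mu>\<close> null) is \<open>\<infinity>\<close>.\<close>

definition Gap :: "'a measure \<Rightarrow> ('a \<Rightarrow> 'a measure) \<Rightarrow> ereal" where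
  "Gap \<mu> K =
     (INF f\<in>{f \<in> L2_zero \<mu>. L2_inner \<mu> f f \<noteq> 0}. ereal (dirichlet \<mu> K f / L2_inner \<mu> f f))"

section \<open>Stationary chain and asymptotic variance\<close>

text \<open>The law on path space of the chain started from \<open>\<mu>\<close> with transition kernel \<open>K\<close>, given by the
  Ionescu-Tulcea theorem. Time starts at \<open>0\<close>.\<close>

definition chain_step :: "'a measure \<Rightarrow> ('a \<Rightarrow> 'a measure) \<Rightarrow> nat \<Rightarrow> (nat \<Rightarrow> 'a) \<Rightarrow> 'a measure" where
  "chain_step \<mu> K n \<xi> = (case n of 0 \<Rightarrow> \<mu> | Suc m \<Rightarrow> K (\<xi> m))"

definition chain_law :: "'a measure \<Rightarrow> ('a \<Rightarrow> 'a measure) \<Rightarrow> (nat \<Rightarrow> 'a) measure" where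
  "chain_law \<mu> K =
     projective_family.lim UNIV (Ionescu_Tulcea.CI (chain_step \<mu> K) (\<lambda>_. \<mu>)) (\<lambda>_. \<mu>)"

lemma Ionescu_Tulcea_chain_step:
  assumes "prob_space \<mu>" and K [measurable]: "K \<in> \<mu> \<rightarrow>\<^sub>M prob_algebra \<mu>"
  shows "Ionescu_Tulcea (chain_step \<mu> K) (\<lambda>_. \<mu>)"
proof (rule Ionescu_Tulcea.intro)
  fix n :: nat
  show "chain_step \<mu> K n \<in> PiM {0..<n} (\<lambda>_. \<mu>) \<rightarrow>\<^sub>M subprob_algebra \<mu>"
  proof (cases n)
    case 0
    then show ?thesis
      using assms(1) by (auto simp: chain_step_def[abs_def] space_subprob_algebra
          intro!: measurable_const prob_space_imp_subprob_space)
  next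
    case (Suc m)
    have "(\<lambda>\<xi>. \<xi> m) \<in> PiM {0..<n} (\<lambda>_. \<mu>) \<rightarrow>\<^sub>M \<mu>"
      using Suc by (intro measurable_component_singleton) auto
    then have "(\<lambda>\<xi>. K (\<xi> m)) \<in> PiM {0..<n} (\<lambda>_. \<mu>) \<rightarrow>\<^sub>M subprob_algebra \<mu>"
      using measurable_compose measurable_prob_algebraD[OF K] by blast
    then show ?thesis
      using Suc by (simp add: chain_step_def[abs_def])
  qed
next
  fix n and \<xi> :: "nat \<Rightarrow> 'a"
  assume "\<xi> \<in> space (PiM {0..<n} (\<lambda>_. \<mu>))"
  then show "prob_space (chain_step \<mu> K n \<xi>)"
    using assms(1) measurable_space[OF K]
    by (auto simp: chain_step_def space_prob_algebra space_PiM PiE_iff split: nat.split)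
qed

text \<open>For a \<open>\<mu>\<close>-reversible kernel and \<open>f \<in> L2 \<mu>\<close> the limit exists in \<open>[0, \<infinity>]\<close>.\<close>

definition asym_var :: "'a measure \<Rightarrow> ('a \<Rightarrow> 'a measure) \<Rightarrow> ('a \<Rightarrow> real) \<Rightarrow> ereal" where
  "asym_var \<mu> K f =
     lim (\<lambda>M. ereal (var_wrt (chain_law \<mu> K)
       (\<lambda>\<xi>. 1 / sqrt (real M) * (\<Sum>i<M. f (\<xi> i) - (\<integral>x. f x \<partial>\<mu>)))))"

section \<open>Regular conditional distributions, Gibbs and Metropolis-within-Gibbs kernels\<close>

definition is_cond_snd ::
  "'t measure \<Rightarrow> 'x measure \<Rightarrow> ('t \<times> 'x) measure \<Rightarrow> ('t \<Rightarrow> 'x measure) \<Rightarrow> bool" where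
  "is_cond_snd T X \<pi> \<kappa> \<longleftrightarrow> \<kappa> \<in> T \<rightarrow>\<^sub>M prob_algebra X \<and>
     (\<forall>A\<in>sets T. \<forall>B\<in>sets X.
        emeasure \<pi> (A \<times> B) = (\<integral>\<^sup>+\<theta>\<in>A. emeasure (\<kappa> \<theta>) B \<partial>distr \<pi> T fst))"

definition is_cond_fst ::
  "'t measure \<Rightarrow> 'x measure \<Rightarrow> ('t \<times> 'x) measure \<Rightarrow> ('x \<Rightarrow> 't measure) \<Rightarrow> bool" where
  "is_cond_fst T X \<pi> \<kappa> \<longleftrightarrow> \<kappa> \<in> X \<rightarrow>\<^sub>M prob_algebra T \<and>
     (\<forall>A\<in>sets T. \<forall>B\<in>sets X.
        emeasure \<pi> (A \<times> B) = (\<integral>\<^sup>+x\<in>B. emeasure (\<kappa> x) A \<partial>distr \<pi> X snd))"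

text \<open>In the following, \<open>\<pi>T \<theta>\<close> is the conditional law of the second coordinate given the first one
  equals \<open>\<theta>\<close>, and \<open>\<pi>X x\<close> that of the first given the second one equals \<open>x\<close>.\<close>

definition gibbs_x :: "('x \<Rightarrow> 't measure) \<Rightarrow> ('t \<Rightarrow> 'x measure) \<Rightarrow> 'x \<Rightarrow> 'x measure" where
  "gibbs_x \<pi>X \<pi>T x = \<pi>X x \<bind> \<pi>T"

definition mwg_x :: "('x \<Rightarrow> 't measure) \<Rightarrow> ('t \<Rightarrow> 'x \<Rightarrow> 'x measure) \<Rightarrow> 'x \<Rightarrow> 'x measure" where
  "mwg_x \<pi>X P x = \<pi>X x \<bind> (\<lambda>\<theta>. P \<theta> x)"

lemma emeasure_gibbs_x:
  assumes "\<pi>X \<in> X \<rightarrow>\<^sub>M prob_algebra T" "\<pi>T \<in> T \<rightarrow>\<^sub>M prob_algebra X" "x \<in> space X" "B \<in> sets X"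
  shows "emeasure (gibbs_x \<pi>X \<pi>T x) B = (\<integral>\<^sup>+\<theta>. emeasure (\<pi>T \<theta>) B \<partial>\<pi>X x)"
  unfolding gibbs_x_def using assms
  by (intro emeasure_bind_prob_algebra) (auto dest: measurable_space)

lemma emeasure_mwg_x:
  assumes "\<pi>X \<in> X \<rightarrow>\<^sub>M prob_algebra T" "case_prod P \<in> (T \<Otimes>\<^sub>M X) \<rightarrow>\<^sub>M prob_algebra X"
    and "x \<in> space X" "B \<in> sets X"
  shows "emeasure (mwg_x \<pi>X P x) B = (\<integral>\<^sup>+\<theta>. emeasure (P \<theta> x) B \<partial>\<pi>X x)"
proof -
  have "(\<lambda>\<theta>. P \<theta> x) \<in> T \<rightarrow>\<^sub>M prob_algebra X"
    using measurable_compose[OF measurable_Pair2'[OF assms(3)] assms(2)] by simp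
  then show ?thesis
    unfolding mwg_x_def using assms
    by (intro emeasure_bind_prob_algebra) (auto dest: measurable_space)
qed

text \<open>\<open>\<nu>T\<close> and \<open>\<nu>X\<close> are the marginals. Both integrands are nonnegative, so nothing is lost by
  integrating in \<open>[0, \<infinity>]\<close>; a fibre with infinite gap has only constant functions, so its
  contribution is \<open>0 \<cdot> \<infinity> = 0\<close>. If the gap is not measurable in the parameter, the integral is
  a lower integral. \<open>rho\<close> is \<open>\<infinity>\<close> exactly when no function has a nonzero denominator (every
  \<open>f \<in> L2 \<nu>X\<close> is almost surely constant given the first coordinate); otherwise it lies in \<open>[0, 2]\<close>.\<close>

definition mean_cond_var :: "'t measure \<Rightarrow> ('t \<Rightarrow> 'x measure) \<Rightarrow> ('x \<Rightarrow> real) \<Rightarrow> ennreal" where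
  "mean_cond_var \<nu>T \<pi>T f = (\<integral>\<^sup>+\<theta>. ennreal (var_wrt (\<pi>T \<theta>) f) \<partial>\<nu>T)"

definition mean_cond_var_gap ::
  "'t measure \<Rightarrow> ('t \<Rightarrow> 'x measure) \<Rightarrow> ('t \<Rightarrow> 'x \<Rightarrow> 'x measure) \<Rightarrow> ('x \<Rightarrow> real) \<Rightarrow> ennreal" where
  "mean_cond_var_gap \<nu>T \<pi>T P f =
     (\<integral>\<^sup>+\<theta>. ennreal (var_wrt (\<pi>T \<theta>) f) * e2ennreal (Gap (\<pi>T \<theta>) (P \<theta>)) \<partial>\<nu>T)"

definition rho ::
  "'t measure \<Rightarrow> 'x measure \<Rightarrow> ('t \<Rightarrow> 'x measure) \<Rightarrow> ('t \<Rightarrow> 'x \<Rightarrow> 'x measure) \<Rightarrow> ereal" where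
  "rho \<nu>T \<nu>X \<pi>T P =
     (INF f\<in>{f \<in> L2 \<nu>X. mean_cond_var \<nu>T \<pi>T f \<noteq> 0}.
        enn2ereal (mean_cond_var_gap \<nu>T \<pi>T P f / mean_cond_var \<nu>T \<pi>T f))"

end

theory Submission
  imports Defs
begin

text \<open>Write \<open>\<E>\<^sub>K(f) = \<langle>f, (I - K) f\<rangle>\<close> for the Dirichlet form of a reversible kernel \<open>K\<close>. The theorem has two halves,
  which meet in inequalities of the form \<open>\<E>\<^sub>K \<le> c \<E>\<^sub>L\<close>.

  \<^bold>\<open>Dirichlet forms.\<close> The form \<open>\<E>\<^sub>\<Phi>(f)\<close> is half the mean of \<open>(f x - f y)\<^sup>2\<close> when \<open>x\<close> is stationary, \<open>\<theta>\<close> is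
  drawn given \<open>x\<close>, and \<open>y\<close> is drawn from \<open>P \<theta> x\<close>. Drawing \<open>\<theta>\<close> first and \<open>x\<close> given \<open>\<theta>\<close> produces the same law,
  so \<open>\<E>\<^sub>\<Phi>(f)\<close> is the \<open>\<theta>\<close>-average of the forms \<open>\<E>\<^bsub>P \<theta>\<^esub>(f)\<close> on the fibres (\<open>dirichlet_fibre\<close>). The Gibbs kernel
  is the case \<open>P \<theta> x = \<pi>T \<theta>\<close>, where the fibre form is the conditional variance. Comparing \<open>\<E>\<^sub>\<Phi>\<close> with \<open>\<E>\<^sub>\<Gamma>\<close> is
  thereby reduced to comparing, on a single fibre, the form of \<open>P \<theta>\<close> with the variance: the form is at most
  twice the variance because Markov operators are contractions of \<open>L\<^sup>2\<close> (\<open>dirichlet_le_two_var\<close>), at most \<open>2 - \<epsilon>\<close> times it under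
  a minorisation (\<open>dirichlet_le_var_minorised\<close>), at most the variance under positivity
  (\<open>dirichlet_le_var_positive\<close>), and at least \<open>Gap\<close> times the variance by definition of the gap
  (\<open>Gap_times_var_le\<close>). The spectral gaps of the two samplers are compared by taking infima.

  \<^bold>\<open>Asymptotic variances.\<close> Formally \<open>var(f, K) = 2 \<langle>f, (I - K)\<^sup>-\<^sup>1 f\<rangle> - \<parallel>f\<parallel>\<^sup>2\<close> for centred \<open>f\<close>, and inversion
  reverses the order of positive operators, so \<open>\<E>\<^bsub>K1\<^esub> \<le> c \<E>\<^bsub>K2\<^esub>\<close> gives
  \<open>var(f, K2) + \<parallel>f\<parallel>\<^sup>2 \<le> c (var(f, K1) + \<parallel>f\<parallel>\<^sup>2)\<close> (\<open>asym_var_compare\<close>). The bounds between the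
  asymptotic variances of the two samplers are this inequality with \<open>c\<close> equal to \<open>2\<close>, \<open>1 / \<rho>\<close>, \<open>2 - \<epsilon>\<close> or \<open>1\<close>; the
  bound \<open>var\<^sub>\<pi>(f) \<le> var(f, \<Gamma>)\<close> holds because the Gibbs kernel is positive and so has nonnegative
  autocovariances (\<open>positive_kernel_gibbs\<close>, \<open>var_le_asym_var\<close>). To make the formal argument precise,
  \<open>I - K\<close> is replaced by \<open>I - l K\<close> with \<open>l < 1\<close>. The value \<open>\<langle>f, (I - l K)\<^sup>-\<^sup>1 f\<rangle>\<close> is the Abel sum of the
  autocovariances \<open>\<langle>f, K\<^sup>k f\<rangle>\<close>, and it is the supremum over \<open>g\<close> of \<open>2 \<langle>f, g\<rangle> - \<langle>g, (I - l K) g\<rangle>\<close>, which is approached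
  along finite Neumann sums (\<open>resolvent_lower\<close>, \<open>resolvent_attained\<close>); in this form the order reversal is
  evident (\<open>abel_autocov_compare\<close>). The normalised variances of the partial sums along the chain are Cesaro
  means of the same sequence, and reversibility makes sums over suitable pairs of consecutive autocovariances
  nonnegative. This forces the Cesaro means to converge in \<open>[0, \<infinity>]\<close> and the Abel sums to converge
  correspondingly as \<open>l\<close> tends to 1 (\<open>cesaro_abel\<close>, \<open>asym_var_abel\<close>).\<close>

section \<open>Cesaro and Abel means of an autocovariance sequence\<close>

text \<open>One-sided form of the Cesaro mean theorem: it serves convergence to a real limit and divergence to
  infinity alike, because the finitely many early terms contribute a constant divided by \<open>M\<close>.\<close>

lemma mean_eventually_ge:
  fixes x :: "nat \<Rightarrow> real"
  assumes ev: "eventually (\<lambda>n. C \<le> x n) sequentially" and "e > 0"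
  shows "eventually (\<lambda>M. C - e \<le> (\<Sum>n<M. x n) / real M) sequentially"
proof -
  from ev obtain N where N: "\<And>n. n \<ge> N \<Longrightarrow> C \<le> x n" by (auto simp: eventually_sequentially)
  define D where "D = (\<Sum>n<N. x n - C)"
  have "(\<lambda>M. D / real M) \<longlonglongrightarrow> 0"
    by (rule lim_const_over_n)
  then have "eventually (\<lambda>M. D / real M > - e) sequentially"
    using \<open>e > 0\<close> by (simp add: order_tendstoD)
  then show ?thesis using eventually_ge_at_top[of "max 1 N"]
  proof eventually_elim
    case (elim M)
    have "D \<le> (\<Sum>n<M. x n - C)"
      unfolding D_def using elim N by (intro sum_mono2) auto
    then have "D / real M \<le> (\<Sum>n<M. x n - C) / real M"
      using elim by (intro divide_right_mono) auto
    also have "\<dots> = (\<Sum>n<M. x n) / real M - C"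
      using elim by (simp add: sum_subtractf diff_divide_distrib)
    finally show ?case using elim by linarith
  qed
qed

lemma cesaro_mean_tendsto:
  fixes x :: "nat \<Rightarrow> real"
  assumes "x \<longlonglongrightarrow> L"
  shows "(\<lambda>M. (\<Sum>n<M. x n) / real M) \<longlonglongrightarrow> L"
proof (rule LIMSEQ_I)
  fix r :: real assume "r > 0"
  then have r: "r/4 > 0" by simp
  have 1: "eventually (\<lambda>n. L - r/4 \<le> x n) sequentially" "eventually (\<lambda>n. - L - r/4 \<le> - x n) sequentially"
    using order_tendstoD(1)[OF assms, of "L - r/4"] order_tendstoD(2)[OF assms, of "L + r/4"] r
    by (auto elim: eventually_mono)
  have "eventually (\<lambda>M. norm ((\<Sum>n<M. x n) / real M - L) < r) sequentially"
    using mean_eventually_ge[OF 1(1) r] mean_eventually_ge[OF 1(2) r]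
  proof eventually_elim
    case (elim M)
    then show ?case using \<open>r > 0\<close> by (simp add: sum_negf abs_less_iff)
  qed
  then show "\<exists>no. \<forall>M\<ge>no. norm ((\<Sum>n<M. x n) / real M - L) < r"
    by (simp add: eventually_sequentially)
qed

text \<open>The properties of \<open>a k = \<langle>f, K\<^sup>k f\<rangle>\<close> that decide how its means behave. With \<open>g = K\<^sup>m f\<close>, the paired
  sum is \<open>\<langle>g, (I + K) g\<rangle>\<close> and the triple one is \<open>\<parallel>(I + K) g\<parallel>\<^sup>2\<close>. Individual odd terms may be negative.\<close>

locale paired_autocovariance =
  fixes a :: "nat \<Rightarrow> real"
  assumes pair_nonneg: "\<And>m. 0 \<le> a (2 * m) + a (2 * m + 1)"
    and triple_nonneg: "\<And>m. 0 \<le> a (2 * m) + 2 * a (2 * m + 1) + a (2 * m + 2)"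
    and bounded: "\<And>k. \<bar>a k\<bar> \<le> a 0"
begin

text \<open>For \<open>n \<ge> 1\<close> this is \<open>a 0 + 2 (a 1 + \<dots> + a (n - 1)) + a n\<close>, in which the end points carry half weight. These
  sums increase along even \<open>n\<close> and converge in \<open>[0, \<infinity>]\<close>, whereas the plain partial sums can oscillate for
  ever, as for the deterministic flip of two points, where \<open>a k = (- 1)\<^sup>k\<close>.\<close>

definition trapezoid :: "nat \<Rightarrow> real" where
  "trapezoid n = (\<Sum>k<n. a k + a (Suc k))"

text \<open>This is \<open>a 0 + 2 (\<Sum>k=1..M - 1. (1 - k / M) a k)\<close>, the variance of the sum of \<open>M\<close> stationary steps divided by \<open>M\<close>, written
  as a Cesaro mean.\<close>

definition partial_variance :: "nat \<Rightarrow> real" where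
  "partial_variance M = (\<Sum>n<M. trapezoid n + a n) / real M"

definition abel_sum :: "real \<Rightarrow> real" where
  "abel_sum l = (\<Sum>k. l ^ k * a k)"

lemma a0_nonneg: "0 \<le> a 0"
  using bounded[of 0] by linarith

lemma summable_abel:
  assumes "0 \<le> l" "l < 1"
  shows "summable (\<lambda>k. l ^ k * a (k + j))"
proof (rule summable_comparison_test')
  show "summable (\<lambda>k. l ^ k * a 0)"
    using assms by (intro summable_mult2 summable_geometric) auto
  show "norm (l ^ k * a (k + j)) \<le> l ^ k * a 0" if "k \<ge> 0" for k
    using assms bounded by (auto simp: abs_mult intro!: mult_left_mono)
qed

text \<open>Passes from the Abel sum of \<open>a k\<close> to that of \<open>a k + a (k + 1)\<close>, whose partial sums are monotone along
  even indices.\<close>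

lemma abel_trapezoid:
  assumes "0 < l" "l < 1"
  shows "(\<lambda>k. l ^ k * (a k + a (Suc k))) sums (abel_sum l + (abel_sum l - a 0) / l)"
proof -
  have 1: "(\<lambda>k. l ^ k * a k) sums abel_sum l"
    using summable_abel[of l 0] assms unfolding abel_sum_def by (simp add: summable_sums)
  then have "(\<lambda>k. l ^ Suc k * a (Suc k)) sums (abel_sum l - a 0)"
    by (subst sums_Suc_iff) simp
  then have "(\<lambda>k. (1 / l) * (l ^ Suc k * a (Suc k))) sums ((1 / l) * (abel_sum l - a 0))"
    by (rule sums_mult)
  then have "(\<lambda>k. l ^ k * a (Suc k)) sums ((abel_sum l - a 0) / l)"
    using assms by simp
  from sums_add[OF 1 this] show ?thesis by (simp add: algebra_simps)
qed

lemma trapezoid_add: "trapezoid n + a n = 2 * (\<Sum>k<n. a (Suc k)) + a 0"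
  by (induction n) (auto simp: trapezoid_def)

lemma trapezoid_even_mono: "mono (\<lambda>m. trapezoid (2 * m))"
proof (rule incseq_SucI)
  fix n show "trapezoid (2 * n) \<le> trapezoid (2 * Suc n)"
    using triple_nonneg[of n] by (simp add: trapezoid_def)
qed

lemma trapezoid_odd_ge: "trapezoid (2 * m) \<le> trapezoid (2 * m + 1)"
  using pair_nonneg[of m] by (simp add: trapezoid_def)

lemma trapezoid_even_le:
  assumes "2 * m \<le> n" shows "trapezoid (2 * m) \<le> trapezoid n"
proof -
  have 1: "trapezoid (2 * m) \<le> trapezoid (2 * (n div 2))"
    using assms by (intro monoD[OF trapezoid_even_mono]) simp
  show ?thesis
  proof (cases "even n")
    case True then show ?thesis using 1 by simp
  next
    case False
    then have "n = 2 * (n div 2) + 1" by simp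
    then show ?thesis using 1 trapezoid_odd_ge[of "n div 2"] by simp
  qed
qed

lemma trapezoid_even_eq: "trapezoid (2 * m) = 2 * (\<Sum>k<2*m. a k) - a 0 + a (2 * m)"
  by (induction m) (auto simp: trapezoid_def)

lemma sum_pairs_eq: "(\<Sum>k<2*m. a k) = (\<Sum>k<m. a (2*k) + a (2*k+1))" for m :: nat
  by (induction m) auto

text \<open>Along even indices the trapezoid sums increase. If they stay bounded, the paired sums
  \<open>a (2 m) + a (2 m + 1)\<close> are summable, so odd and even trapezoid sums have the same limit and the partial
  sums of \<open>a\<close> are bounded.\<close>

lemma trapezoid_sums_or_diverges:
  "(\<exists>L. (\<lambda>k. a k + a (Suc k)) sums L \<and> (\<exists>B. \<forall>n. \<bar>\<Sum>k<n. a k\<bar> \<le> B)) \<or> filterlim trapezoid at_top sequentially"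
proof (cases "\<exists>B. \<forall>m. trapezoid (2 * m) \<le> B")
  case True
  then obtain B where B: "\<And>m. trapezoid (2 * m) \<le> B" by auto
  let ?b = "\<lambda>k. a (2*k) + a (2*k+1)"
  have S: "(\<Sum>k<m. ?b k) \<le> B + a 0" for m
  proof -
    have "0 \<le> B" using B[of 0] by (simp add: trapezoid_def)
    then show ?thesis
      using B[of m] trapezoid_even_eq[of m] bounded[of "2*m"]
      unfolding sum_pairs_eq by linarith
  qed
  have sb: "summable ?b"
  proof (rule bounded_imp_summable)
    show "0 \<le> ?b m" for m by (rule pair_nonneg)
    show "(\<Sum>k\<le>n. ?b k) \<le> B + a 0" for n
      using S[of "Suc n"] unfolding lessThan_Suc_atMost .
  qed
  then have b0: "?b \<longlonglongrightarrow> 0" by (rule summable_LIMSEQ_zero)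
  obtain L where L: "(\<lambda>m. trapezoid (2 * m)) \<longlonglongrightarrow> L"
    using incseq_convergent[OF trapezoid_even_mono, of B] B by blast
  have "(\<lambda>m. trapezoid (2 * m + 1)) \<longlonglongrightarrow> L"
  proof -
    have "(\<lambda>m. trapezoid (2 * m) + ?b m) \<longlonglongrightarrow> L + 0"
      by (intro tendsto_add L b0)
    then show ?thesis by (simp add: trapezoid_def)
  qed
  note odd = this
  have half: "filterlim (\<lambda>n::nat. n div 2) sequentially sequentially"
    by (rule filterlim_at_top_div_const_nat) simp
  have T: "trapezoid \<longlonglongrightarrow> L"
  proof (rule real_tendsto_sandwich)
    show "(\<lambda>n. trapezoid (2 * (n div 2))) \<longlonglongrightarrow> L" "(\<lambda>n. trapezoid (2 * (n div 2) + 1)) \<longlonglongrightarrow> L"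
      using filterlim_compose[OF L half] filterlim_compose[OF odd half] by simp_all
    have "trapezoid n \<le> trapezoid (2 * (n div 2) + 1)" for n
      using trapezoid_odd_ge[of "n div 2"] by (cases "even n") simp_all
    then show "\<forall>\<^sub>F n in sequentially. trapezoid n \<le> trapezoid (2 * (n div 2) + 1)"
      by simp
    show "\<forall>\<^sub>F n in sequentially. trapezoid (2 * (n div 2)) \<le> trapezoid n"
      by (simp add: trapezoid_even_le)
  qed
  then have "(\<lambda>k. a k + a (Suc k)) sums L"
    unfolding sums_def trapezoid_def by simp
  moreover have "\<bar>\<Sum>k<n. a k\<bar> \<le> B + 2 * a 0" for n
  proof -
    have E: "0 \<le> (\<Sum>k<2*m. a k)" "(\<Sum>k<2*m. a k) \<le> B + a 0" for m
      using S[of m] pair_nonneg unfolding sum_pairs_eq by (auto intro: sum_nonneg)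
    have "n = 2 * (n div 2) \<or> n = Suc (2 * (n div 2))" by presburger
    then show ?thesis
    proof
      assume "n = 2 * (n div 2)"
      then show ?thesis using E[of "n div 2"] a0_nonneg by (metis abs_of_nonneg add_increasing2 add.assoc mult_2)
    next
      assume n: "n = Suc (2 * (n div 2))"
      then have "(\<Sum>k<n. a k) = (\<Sum>k<2*(n div 2). a k) + a (2 * (n div 2))"
        by (metis sum.lessThan_Suc)
      then show ?thesis using E[of "n div 2"] bounded[of "2 * (n div 2)"] by linarith
    qed
  qed
  ultimately show ?thesis by blast
next
  case False
  have "filterlim trapezoid at_top sequentially"
    unfolding filterlim_at_top
  proof
    fix Z
    from False obtain m where "Z < trapezoid (2 * m)" by (auto simp: not_le)
    then have "n \<ge> 2 * m \<Longrightarrow> Z \<le> trapezoid n" for n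
      using trapezoid_even_le[of m n] by simp
    then show "\<forall>\<^sub>F n in sequentially. Z \<le> trapezoid n"
      by (auto simp: eventually_sequentially)
  qed
  then show ?thesis ..
qed

text \<open>Positive operators have nonnegative autocovariances, and then correlation only increases the variance.\<close>

lemma partial_variance_ge:
  assumes "\<And>k. 0 \<le> a k" and "M > 0"
  shows "a 0 \<le> partial_variance M"
proof -
  have "(\<Sum>n<M. a 0) \<le> (\<Sum>n<M. trapezoid n + a n)"
    using assms by (intro sum_mono) (simp add: trapezoid_add sum_nonneg)
  then show ?thesis
    using assms(2) by (simp add: partial_variance_def pos_le_divide_eq mult.commute)
qed

lemma abel_partial_limit:
  assumes "0 < l" "l < 1"
  shows "(\<lambda>m. \<Sum>k<2*m. l ^ k * (a k + a (Suc k))) \<longlonglongrightarrow> abel_sum l + (abel_sum l - a 0) / l"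
  using abel_trapezoid[OF assms] LIMSEQ_subseq_LIMSEQ[of "\<lambda>n. \<Sum>k<n. l ^ k * (a k + a (Suc k))" _ "\<lambda>m. 2 * m"]
  by (simp add: sums_def strict_mono_def comp_def)

text \<open>Grouped in pairs, the weighted series has nonnegative terms, since
  \<open>d + l d' = (1 - l) d + l (d + d')\<close> for the term \<open>d\<close> of an even index and its
  successor \<open>d'\<close>. Hence it dominates its even partial sums.\<close>

lemma abel_sum_ge:
  assumes "0 < l" "l < 1"
  shows "(\<Sum>k<2*N. l ^ k * (a k + a (Suc k))) \<le> abel_sum l + (abel_sum l - a 0) / l"
proof (rule LIMSEQ_le_const[OF abel_partial_limit[OF assms]])
  let ?S = "\<lambda>n. \<Sum>k<n. l ^ k * (a k + a (Suc k))"
  have inc: "?S (2 * m) \<le> ?S (2 * Suc m)" for m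
  proof -
    have "0 \<le> l ^ (2*m) * ((1 - l) * (a (2*m) + a (2*m+1)) + l * (a (2*m) + 2 * a (2*m+1) + a (2*m+2)))"
      using assms pair_nonneg[of m] triple_nonneg[of m] by simp
    also have "\<dots> = ?S (2 * Suc m) - ?S (2 * m)"
      by (simp add: algebra_simps)
    finally show ?thesis by simp
  qed
  show "\<exists>M. \<forall>m\<ge>M. ?S (2 * N) \<le> ?S (2 * m)"
    using lift_Suc_mono_le[of "\<lambda>m. ?S (2 * m)" N] inc by blast
qed

text \<open>In the same grouping each pair is at most \<open>(1 - l) (a (2 m) + a (2 m + 1))\<close> plus the increment of the
  trapezoid sum.\<close>

lemma abel_sum_le:
  assumes l: "0 < l" "l < 1" and B: "\<And>n. (\<Sum>k<n. a k) \<le> B" and L: "\<And>m. trapezoid (2 * m) \<le> L"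
  shows "abel_sum l + (abel_sum l - a 0) / l \<le> (1 - l) * B + L"
proof (rule LIMSEQ_le_const2[OF abel_partial_limit[OF l]])
  let ?S = "\<lambda>n. \<Sum>k<n. l ^ k * (a k + a (Suc k))"
  have S: "?S (2 * m) \<le> (1 - l) * (\<Sum>k<2*m. a k) + trapezoid (2 * m)" for m
  proof (induction m)
    case (Suc m)
    let ?t = "(1 - l) * (a (2*m) + a (2*m+1)) + l * (a (2*m) + 2 * a (2*m+1) + a (2*m+2))"
    have t: "0 \<le> ?t" using l pair_nonneg[of m] triple_nonneg[of m] by simp
    have "?S (2 * Suc m) - ?S (2 * m) = l ^ (2*m) * ?t"
      by (simp add: algebra_simps)
    also have "\<dots> \<le> 1 * ?t"
      using l t by (intro mult_right_mono power_le_one) auto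
    also have "\<dots> \<le> (1 - l) * (a (2*m) + a (2*m+1)) + 1 * (a (2*m) + 2 * a (2*m+1) + a (2*m+2))"
      using l triple_nonneg[of m] unfolding mult_1 by (intro add_left_mono mult_left_le_one_le) auto
    finally show ?case using Suc by (simp add: trapezoid_def algebra_simps)
  qed (simp add: trapezoid_def)
  have "?S (2 * m) \<le> (1 - l) * B + L" for m
  proof -
    have "(1 - l) * (\<Sum>k<2*m. a k) \<le> (1 - l) * B"
      using l B by (intro mult_left_mono) auto
    then show ?thesis using S[of m] L[of m] by linarith
  qed
  then show "\<exists>N. \<forall>m\<ge>N. ?S (2 * m) \<le> (1 - l) * B + L" by blast
qed

text \<open>An Abelian theorem valid also for the limit \<open>\<infinity>\<close>. The Cesaro limit \<open>L\<close> is the limit of the trapezoid sums;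
  the shift by \<open>a 0\<close> in the Abel limit comes from \<open>L\<close> counting \<open>a 0\<close> once and every other term twice.\<close>

lemma cesaro_abel:
  obtains L where "(\<lambda>M. ereal (partial_variance M)) \<longlonglongrightarrow> L"
    and "((\<lambda>l. ereal (abel_sum l)) \<longlongrightarrow> (L + ereal (a 0)) / 2) (at_left 1)"
proof -
  have near: "eventually (\<lambda>l::real. 0 < l \<and> l < 1) (at_left 1)"
    unfolding eventually_at_left_field by (intro exI[of _ 0]) auto
  let ?d = "\<lambda>k. a k + a (Suc k)" and ?D = "\<lambda>l. abel_sum l + (abel_sum l - a 0) / l"
  have Deq: "abel_sum l = (l * ?D l + a 0) / (1 + l)" if "0 < l \<and> l < 1" for l
  proof -
    have "l * ?D l + a 0 = (1 + l) * abel_sum l" using that by (simp add: field_simps)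
    then show ?thesis using that by simp
  qed
  from trapezoid_sums_or_diverges show thesis
  proof (elim disjE exE conjE)
    fix L B assume L: "?d sums L" and B: "\<forall>n. \<bar>\<Sum>k<n. a k\<bar> \<le> B"
    have 1: "(\<lambda>M. (\<Sum>n<M. trapezoid n) / real M) \<longlonglongrightarrow> L"
      using L unfolding sums_def trapezoid_def[symmetric] by (rule cesaro_mean_tendsto)
    have 2: "(\<lambda>M. (\<Sum>n<M. a n) / real M) \<longlonglongrightarrow> 0"
    proof (rule tendsto_rabs_zero_cancel, rule tendsto_sandwich[of "\<lambda>_. 0"])
      show "(\<lambda>M. B / real M) \<longlonglongrightarrow> 0" by (rule lim_const_over_n)
      show "\<forall>\<^sub>F M in sequentially. \<bar>(\<Sum>n<M. a n) / real M\<bar> \<le> B / real M"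
        using B by (auto simp: abs_divide intro!: always_eventually divide_right_mono)
    qed auto
    have 3: "partial_variance \<longlonglongrightarrow> L"
      using tendsto_add[OF 1 2] unfolding partial_variance_def
      by (simp add: sum.distrib add_divide_distrib)
    have 4: "(?D \<longlongrightarrow> L) (at_left 1)"
    proof (rule order_tendstoI)
      have T: "trapezoid \<longlonglongrightarrow> L"
        using L unfolding sums_def trapezoid_def .
      fix y
      {
        assume "y < L"
        then obtain N where "\<And>n. n \<ge> N \<Longrightarrow> y < trapezoid n"
          using order_tendstoD(1)[OF T, of y] by (auto simp: eventually_sequentially)
        then have "y < trapezoid (2 * N)" by simp
        moreover have "((\<lambda>l. \<Sum>k<2*N. l ^ k * ?d k) \<longlongrightarrow> (\<Sum>k<2*N. 1 ^ k * ?d k)) (at_left 1)"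
          by (intro tendsto_intros)
        ultimately have "eventually (\<lambda>l. y < (\<Sum>k<2*N. l ^ k * ?d k)) (at_left 1)"
          by (intro order_tendstoD(1)) (auto simp: trapezoid_def)
        with near show "eventually (\<lambda>l. y < ?D l) (at_left 1)"
          by eventually_elim (use abel_sum_ge[of _ N] in \<open>auto intro: less_le_trans\<close>)
      next
        assume "L < y"
        have le: "trapezoid (2 * m) \<le> L" for m
          by (rule LIMSEQ_le_const[OF T]) (use trapezoid_even_le in blast)
        have "((\<lambda>l. (1 - l) * B + L) \<longlongrightarrow> (1 - 1) * B + L) (at_left 1)"
          by (intro tendsto_intros)
        then have "eventually (\<lambda>l. (1 - l) * B + L < y) (at_left 1)"
          using \<open>L < y\<close> by (intro order_tendstoD(2)) auto
        with near show "eventually (\<lambda>l. ?D l < y) (at_left 1)"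
        proof eventually_elim
          case (elim l)
          then have "?D l \<le> (1 - l) * B + L"
            using B le by (intro abel_sum_le) (auto simp: abs_le_iff)
          then show ?case using elim by simp
        qed
      }
    qed
    have "((\<lambda>l. (l * ?D l + a 0) / (1 + l)) \<longlongrightarrow> (1 * L + a 0) / (1 + 1)) (at_left 1)"
      by (intro tendsto_intros 4) auto
    moreover have "eventually (\<lambda>l. (l * ?D l + a 0) / (1 + l) = abel_sum l) (at_left 1)"
      using near by eventually_elim (use Deq in simp)
    ultimately have "(abel_sum \<longlongrightarrow> (1 * L + a 0) / (1 + 1)) (at_left 1)"
      by (rule Lim_transform_eventually)
    then show thesis
      using that[of "ereal L"] 3 by simp
  next
    assume T: "filterlim trapezoid at_top sequentially"
    have "filterlim partial_variance at_top sequentially"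
      unfolding filterlim_at_top
    proof
      fix Z
      have "eventually (\<lambda>n. Z + 1 \<le> trapezoid n + a n) sequentially"
        using filterlim_at_top[THEN iffD1, OF T, rule_format, of "Z + 1 + a 0"]
      proof eventually_elim
        case (elim n) then show ?case using bounded[of n] by linarith
      qed
      from mean_eventually_ge[OF this, of 1]
      show "eventually (\<lambda>M. Z \<le> partial_variance M) sequentially"
        unfolding partial_variance_def by simp
    qed
    then have 1: "(\<lambda>M. ereal (partial_variance M)) \<longlonglongrightarrow> \<infinity>"
      by (simp add: tendsto_PInfty_eq_at_top)
    have D: "filterlim ?D at_top (at_left 1)"
      unfolding filterlim_at_top
    proof
      fix Z
      obtain N where "\<And>n. n \<ge> N \<Longrightarrow> Z + 1 \<le> trapezoid n"
        using filterlim_at_top[THEN iffD1, OF T, rule_format, of "Z + 1"]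
        by (auto simp: eventually_sequentially)
      then have "Z + 1 \<le> trapezoid (2 * N)" by simp
      moreover have "((\<lambda>l. \<Sum>k<2*N. l ^ k * ?d k) \<longlongrightarrow> (\<Sum>k<2*N. 1 ^ k * ?d k)) (at_left 1)"
        by (intro tendsto_intros)
      ultimately have "eventually (\<lambda>l. Z < (\<Sum>k<2*N. l ^ k * ?d k)) (at_left 1)"
        by (intro order_tendstoD(1)) (auto simp: trapezoid_def)
      with near show "eventually (\<lambda>l. Z \<le> ?D l) (at_left 1)"
        by eventually_elim (use abel_sum_ge[of _ N] in \<open>auto intro: order_trans[OF less_imp_le]\<close>)
    qed
    have "filterlim abel_sum at_top (at_left 1)"
      unfolding filterlim_at_top
    proof
      fix Z
      have "eventually (\<lambda>l::real. 1/2 < l) (at_left 1)"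
        unfolding eventually_at_left_field by (intro exI[of _ "1/2"]) auto
      then show "eventually (\<lambda>l. Z \<le> abel_sum l) (at_left 1)"
        using near filterlim_at_top[THEN iffD1, OF D, rule_format, of "4 * \<bar>Z\<bar>"]
      proof eventually_elim
        case (elim l)
        have "Z * (1 + l) \<le> \<bar>Z\<bar> * 2" using elim by (intro mult_mono) auto
        also have "\<dots> = (1/2) * (4 * \<bar>Z\<bar>)" by simp
        also have "\<dots> \<le> l * ?D l" using elim by (intro mult_mono) auto
        also have "\<dots> \<le> l * ?D l + a 0" using a0_nonneg by simp
        finally have "Z \<le> (l * ?D l + a 0) / (1 + l)" using elim by (subst pos_le_divide_eq) auto
        then show ?case using Deq elim by simp
      qed
    qed
    then have "((\<lambda>l. ereal (abel_sum l)) \<longlongrightarrow> (\<infinity> + ereal (a 0)) / 2) (at_left 1)"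
      by (simp add: tendsto_PInfty_eq_at_top)
    with 1 show thesis by (rule that)
  qed
qed

end

section \<open>Integration against kernels and joint laws\<close>

lemma nn_integral_bind_kernel:
  assumes "sets M = sets M'" "K \<in> M' \<rightarrow>\<^sub>M prob_algebra N" "F \<in> borel_measurable N"
  shows "(\<integral>\<^sup>+y. F y \<partial>(M \<bind> K)) = (\<integral>\<^sup>+x. \<integral>\<^sup>+y. F y \<partial>K x \<partial>M)"
proof (rule nn_integral_bind[OF assms(3)])
  show "K \<in> M \<rightarrow>\<^sub>M subprob_algebra N"
    using measurable_prob_algebraD[OF assms(2)] assms(1) by (simp cong: measurable_cong_sets)
qed

text \<open>Fubini for a kernel and an unbounded integrand, obtained from the nonnegative case by splitting into
  positive and negative part.\<close>

lemma integral_bind_kernel: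
  fixes F :: "'b \<Rightarrow> real"
  assumes K: "K \<in> M \<rightarrow>\<^sub>M prob_algebra N" and ne: "space M \<noteq> {}"
    and int: "integrable (M \<bind> K) F"
  shows "AE x in M. integrable (K x) F"
    and "integrable M (\<lambda>x. \<integral>y. F y \<partial>K x)"
    and "(\<integral>y. F y \<partial>(M \<bind> K)) = (\<integral>x. \<integral>y. F y \<partial>K x \<partial>M)"
proof -
  have Ks: "K \<in> M \<rightarrow>\<^sub>M subprob_algebra N" using K by (rule measurable_prob_algebraD)
  have setsK: "sets (K x) = sets N" if "x \<in> space M" for x
    using sets_kernel[OF Ks that] .
  have "sets (M \<bind> K) = sets N" by (rule sets_bind[OF setsK ne])
  then have F [measurable]: "F \<in> borel_measurable N"
    using borel_measurable_integrable[OF int] by (simp cong: measurable_cong_sets)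
  have FK: "F \<in> borel_measurable (K x)" if "x \<in> space M" for x
    using F setsK[OF that] by (simp cong: measurable_cong_sets)
  let ?p = "\<lambda>x. \<integral>\<^sup>+y. ennreal (F y) \<partial>K x" and ?n = "\<lambda>x. \<integral>\<^sup>+y. ennreal (- F y) \<partial>K x"
  have mp: "?p \<in> borel_measurable M" "?n \<in> borel_measurable M"
    by (rule measurable_compose[OF Ks], measurable)+
  have mi: "(\<lambda>x. \<integral>y. F y \<partial>K x) \<in> borel_measurable M"
    by (rule measurable_compose[OF Ks], measurable)
  have eqp: "(\<integral>\<^sup>+y. ennreal (F y) \<partial>(M \<bind> K)) = (\<integral>\<^sup>+x. ?p x \<partial>M)"
    "(\<integral>\<^sup>+y. ennreal (- F y) \<partial>(M \<bind> K)) = (\<integral>\<^sup>+x. ?n x \<partial>M)"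
    by (rule nn_integral_bind_kernel[OF refl K], measurable)+
  have fin: "(\<integral>\<^sup>+x. ?p x \<partial>M) \<noteq> \<infinity>" "(\<integral>\<^sup>+x. ?n x \<partial>M) \<noteq> \<infinity>"
    using int eqp unfolding real_integrable_def by auto
  have aep: "AE x in M. ?p x \<noteq> \<infinity>" "AE x in M. ?n x \<noteq> \<infinity>"
    using nn_integral_PInf_AE[OF mp(1)] nn_integral_PInf_AE[OF mp(2)] fin by auto
  show ae: "AE x in M. integrable (K x) F"
    using aep AE_space by eventually_elim (auto simp: real_integrable_def FK)
  have eqF: "AE x in M. (\<integral>y. F y \<partial>K x) = enn2real (?p x) - enn2real (?n x)"
    using ae by eventually_elim (rule real_lebesgue_integral_def)
  have ei: "(\<integral>\<^sup>+x. ennreal (enn2real (?p x)) \<partial>M) = (\<integral>\<^sup>+x. ?p x \<partial>M)"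
    "(\<integral>\<^sup>+x. ennreal (enn2real (?n x)) \<partial>M) = (\<integral>\<^sup>+x. ?n x \<partial>M)"
    by (rule nn_integral_cong_AE, use aep(1) in eventually_elim, simp add: top.not_eq_extremum)
      (rule nn_integral_cong_AE, use aep(2) in eventually_elim, simp add: top.not_eq_extremum)
  have ip: "integrable M (\<lambda>x. enn2real (?p x))" "integrable M (\<lambda>x. enn2real (?n x))"
    using fin ei mp by (auto intro!: integrableI_nonneg simp: top.not_eq_extremum)
  have iv: "(\<integral>x. enn2real (?p x) \<partial>M) = enn2real (\<integral>\<^sup>+x. ?p x \<partial>M)"
    "(\<integral>x. enn2real (?n x) \<partial>M) = enn2real (\<integral>\<^sup>+x. ?n x \<partial>M)"
    using ei mp by (auto simp: integral_eq_nn_integral)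
  show "integrable M (\<lambda>x. \<integral>y. F y \<partial>K x)"
    using integrable_cong_AE[OF mi _ eqF] ip mp by simp
  show "(\<integral>y. F y \<partial>(M \<bind> K)) = (\<integral>x. \<integral>y. F y \<partial>K x \<partial>M)"
    using integral_cong_AE[OF mi _ eqF] ip mp
    by (simp add: real_lebesgue_integral_def[OF int] eqp iv)
qed

text \<open>The law of \<open>(x, y)\<close> with \<open>x\<close> drawn from \<open>M\<close> and \<open>y\<close> from \<open>K x\<close>. Reversibility of \<open>K\<close> is the symmetry of this
  law, and conditional distributions are the kernels that reproduce a given joint law.\<close>

definition joint_law :: "'a measure \<Rightarrow> 'b measure \<Rightarrow> ('a \<Rightarrow> 'b measure) \<Rightarrow> ('a \<times> 'b) measure" where
  "joint_law M N K = M \<bind> (\<lambda>x. distr (K x) (M \<Otimes>\<^sub>M N) (Pair x))"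

context
  fixes M :: "'a measure" and N :: "'b measure" and K :: "'a \<Rightarrow> 'b measure"
  assumes pM: "prob_space M" and K: "K \<in> M \<rightarrow>\<^sub>M prob_algebra N"
begin

lemma joint_kernel: "(\<lambda>x. distr (K x) (M \<Otimes>\<^sub>M N) (Pair x)) \<in> M \<rightarrow>\<^sub>M prob_algebra (M \<Otimes>\<^sub>M N)"
  using K by (intro measurable_distr_prob_space2[of _ _ N]) auto

lemma sets_joint_law: "sets (joint_law M N K) = sets (M \<Otimes>\<^sub>M N)"
  unfolding joint_law_def using pM
  by (intro sets_bind'[OF _ joint_kernel]) (simp add: space_prob_algebra)

lemma prob_space_joint_law: "prob_space (joint_law M N K)"
  unfolding joint_law_def using pM
  by (intro prob_space_bind'[OF _ joint_kernel]) (simp add: space_prob_algebra)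

lemma kernel_sets: "x \<in> space M \<Longrightarrow> sets (K x) = sets N"
  and kernel_prob: "x \<in> space M \<Longrightarrow> prob_space (K x)"
  using measurable_space[OF K, of x] by (auto simp: space_prob_algebra)

lemma nn_integral_joint_law:
  assumes [measurable]: "F \<in> borel_measurable (M \<Otimes>\<^sub>M N)"
  shows "(\<integral>\<^sup>+z. F z \<partial>joint_law M N K) = (\<integral>\<^sup>+x. \<integral>\<^sup>+y. F (x, y) \<partial>K x \<partial>M)"
  unfolding joint_law_def
  apply (subst nn_integral_bind_kernel[OF refl joint_kernel assms])
  apply (rule nn_integral_cong)
  apply (subst nn_integral_distr)
  apply (auto simp: kernel_sets cong: measurable_cong_sets)
  done

lemma integral_joint_law:
  fixes F :: "'a \<times> 'b \<Rightarrow> real"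
  assumes int: "integrable (joint_law M N K) F"
  shows "AE x in M. integrable (K x) (\<lambda>y. F (x, y))"
    and "integrable M (\<lambda>x. \<integral>y. F (x, y) \<partial>K x)"
    and "(\<integral>z. F z \<partial>joint_law M N K) = (\<integral>x. \<integral>y. F (x, y) \<partial>K x \<partial>M)"
proof -
  have [measurable]: "F \<in> borel_measurable (M \<Otimes>\<^sub>M N)"
    using borel_measurable_integrable[OF int] by (simp cong: measurable_cong_sets add: sets_joint_law)
  note B = integral_bind_kernel[OF joint_kernel prob_space.not_empty[OF pM] int[unfolded joint_law_def]]
  have P: "Pair x \<in> K x \<rightarrow>\<^sub>M M \<Otimes>\<^sub>M N" if "x \<in> space M" for x
    using that by (simp add: kernel_sets cong: measurable_cong_sets)
  have eq: "(\<integral>y. F y \<partial>distr (K x) (M \<Otimes>\<^sub>M N) (Pair x)) = (\<integral>y. F (x, y) \<partial>K x)" if "x \<in> space M" for x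
    by (rule integral_distr[OF P[OF that]]) simp
  show "AE x in M. integrable (K x) (\<lambda>y. F (x, y))"
    using B(1) AE_space by eventually_elim (auto dest: integrable_distr[OF P])
  show "integrable M (\<lambda>x. \<integral>y. F (x, y) \<partial>K x)"
    using B(2) eq by (simp cong: Bochner_Integration.integrable_cong)
  show "(\<integral>z. F z \<partial>joint_law M N K) = (\<integral>x. \<integral>y. F (x, y) \<partial>K x \<partial>M)"
    using B(3) eq unfolding joint_law_def by (simp cong: Bochner_Integration.integral_cong)
qed

lemma emeasure_joint_law_Times:
  assumes "A \<in> sets M" "B \<in> sets N"
  shows "emeasure (joint_law M N K) (A \<times> B) = (\<integral>\<^sup>+x\<in>A. emeasure (K x) B \<partial>M)"
proof -
  have "emeasure (joint_law M N K) (A \<times> B) = (\<integral>\<^sup>+z. indicator (A \<times> B) z \<partial>joint_law M N K)"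
    using assms by (subst nn_integral_indicator) (auto simp: sets_joint_law)
  also have "\<dots> = (\<integral>\<^sup>+x. \<integral>\<^sup>+y. indicator (A \<times> B) (x, y) \<partial>K x \<partial>M)"
    using assms by (intro nn_integral_joint_law) auto
  also have "\<dots> = (\<integral>\<^sup>+x\<in>A. emeasure (K x) B \<partial>M)"
  proof (rule nn_integral_cong)
    fix x assume x: "x \<in> space M"
    have "(\<integral>\<^sup>+y. indicator (A \<times> B) (x, y) \<partial>K x) = (\<integral>\<^sup>+y. indicator A x * indicator B y \<partial>K x)"
      by (intro nn_integral_cong) (auto split: split_indicator)
    also have "\<dots> = indicator A x * emeasure (K x) B"
      using assms kernel_sets[OF x] by (subst nn_integral_cmult_indicator) auto
    finally show "(\<integral>\<^sup>+y. indicator (A \<times> B) (x, y) \<partial>K x) = emeasure (K x) B * indicator A x"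
      by (simp add: mult.commute)
  qed
  finally show ?thesis .
qed

lemma joint_law_eqI:
  assumes "sets \<rho> = sets (M \<Otimes>\<^sub>M N)"
    and eq: "\<And>A B. A \<in> sets M \<Longrightarrow> B \<in> sets N \<Longrightarrow> emeasure \<rho> (A \<times> B) = (\<integral>\<^sup>+x\<in>A. emeasure (K x) B \<partial>M)"
  shows "\<rho> = joint_law M N K"
proof -
  interpret J: prob_space "joint_law M N K" by (rule prob_space_joint_law)
  let ?E = "{a \<times> b |a b. a \<in> sets M \<and> b \<in> sets N}"
  have "joint_law M N K = \<rho>"
  proof (rule measure_eqI_generator_eq[of ?E "space M \<times> space N" _ _ "\<lambda>_. space M \<times> space N"])
    show "Int_stable ?E" by (rule Int_stable_pair_measure_generator)
    show "?E \<subseteq> Pow (space M \<times> space N)" by (rule pair_measure_closed)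
    show "sets (joint_law M N K) = sigma_sets (space M \<times> space N) ?E"
      by (simp add: sets_joint_law sets_pair_measure)
    show "sets \<rho> = sigma_sets (space M \<times> space N) ?E"
      by (simp add: assms(1) sets_pair_measure)
    show "X \<in> ?E \<Longrightarrow> emeasure (joint_law M N K) X = emeasure \<rho> X" for X
      using eq by (auto simp: emeasure_joint_law_Times)
  qed (use J.emeasure_finite in auto)
  then show ?thesis ..
qed

end

section \<open>Square-integrable functions and reversible kernels\<close>

lemma L2D:
  assumes "f \<in> L2 \<mu>"
  shows "f \<in> borel_measurable \<mu>" "integrable \<mu> (\<lambda>x. (f x)\<^sup>2)"
  using assms by (auto simp: L2_def)

lemma abs_mult_le_squares: "\<bar>a * b\<bar> \<le> a\<^sup>2 + b\<^sup>2" for a b :: real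
proof -
  have "0 \<le> (\<bar>a\<bar> - \<bar>b\<bar>)\<^sup>2" by simp
  then have "2 * \<bar>a * b\<bar> \<le> a\<^sup>2 + b\<^sup>2" by (simp add: abs_mult power2_diff)
  then show ?thesis using abs_ge_zero[of "a * b"] by linarith
qed

lemma integrable_mult_of_squares:
  fixes f g :: "'a \<Rightarrow> real"
  assumes "f \<in> borel_measurable M" "g \<in> borel_measurable M"
    and "integrable M (\<lambda>x. (f x)\<^sup>2)" "integrable M (\<lambda>x. (g x)\<^sup>2)"
  shows "integrable M (\<lambda>x. f x * g x)"
  using assms abs_mult_le_squares
  by (intro Bochner_Integration.integrable_bound[OF Bochner_Integration.integrable_add[OF assms(3,4)]]) auto

lemma L2_integrable_mult: "f \<in> L2 \<mu> \<Longrightarrow> g \<in> L2 \<mu> \<Longrightarrow> integrable \<mu> (\<lambda>x. f x * g x)"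
  by (auto simp: L2_def intro: integrable_mult_of_squares)

lemma L2_add: "f \<in> L2 \<mu> \<Longrightarrow> g \<in> L2 \<mu> \<Longrightarrow> (\<lambda>x. f x + g x) \<in> L2 \<mu>"
  using L2_integrable_mult[of f \<mu> g]
  by (auto simp: L2_def power2_sum mult.assoc intro!: Bochner_Integration.integrable_add)

lemma L2_scale: "f \<in> L2 \<mu> \<Longrightarrow> (\<lambda>x. c * f x) \<in> L2 \<mu>"
  by (auto simp: L2_def power_mult_distrib)

lemma L2_diff: "f \<in> L2 \<mu> \<Longrightarrow> g \<in> L2 \<mu> \<Longrightarrow> (\<lambda>x. f x - g x) \<in> L2 \<mu>"
  using L2_add[of f \<mu> "\<lambda>x. - 1 * g x"] L2_scale[of g \<mu> "- 1"] by simp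

lemma L2_sum: "(\<And>i. i \<in> I \<Longrightarrow> f i \<in> L2 \<mu>) \<Longrightarrow> (\<lambda>x. \<Sum>i\<in>I. f i x) \<in> L2 \<mu>"
proof (induction I rule: infinite_finite_induct)
  case (insert x F) then show ?case by (auto intro: L2_add)
qed (auto simp: L2_def)

lemma L2_inner_commute: "L2_inner \<mu> f g = L2_inner \<mu> g f"
  by (simp add: L2_inner_def mult.commute)

lemma L2_inner_add_right:
  "f \<in> L2 \<mu> \<Longrightarrow> g \<in> L2 \<mu> \<Longrightarrow> h \<in> L2 \<mu> \<Longrightarrow>
    L2_inner \<mu> f (\<lambda>x. g x + h x) = L2_inner \<mu> f g + L2_inner \<mu> f h"
  by (simp add: L2_inner_def distrib_left L2_integrable_mult)

lemma L2_inner_diff_right: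
  "f \<in> L2 \<mu> \<Longrightarrow> g \<in> L2 \<mu> \<Longrightarrow> h \<in> L2 \<mu> \<Longrightarrow>
    L2_inner \<mu> f (\<lambda>x. g x - h x) = L2_inner \<mu> f g - L2_inner \<mu> f h"
  by (simp add: L2_inner_def right_diff_distrib L2_integrable_mult)

lemma L2_inner_add_left:
  "f \<in> L2 \<mu> \<Longrightarrow> g \<in> L2 \<mu> \<Longrightarrow> h \<in> L2 \<mu> \<Longrightarrow>
    L2_inner \<mu> (\<lambda>x. g x + h x) f = L2_inner \<mu> g f + L2_inner \<mu> h f"
  by (simp add: L2_inner_commute[of \<mu> _ f] L2_inner_add_right)

lemma L2_inner_diff_left:
  "f \<in> L2 \<mu> \<Longrightarrow> g \<in> L2 \<mu> \<Longrightarrow> h \<in> L2 \<mu> \<Longrightarrow>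
    L2_inner \<mu> (\<lambda>x. g x - h x) f = L2_inner \<mu> g f - L2_inner \<mu> h f"
  by (simp add: L2_inner_commute[of \<mu> _ f] L2_inner_diff_right)

lemma L2_inner_scale_right: "L2_inner \<mu> f (\<lambda>x. c * g x) = c * L2_inner \<mu> f g"
  by (simp add: L2_inner_def mult.left_commute)

lemma L2_inner_scale_left: "L2_inner \<mu> (\<lambda>x. c * g x) f = c * L2_inner \<mu> g f"
  by (simp add: L2_inner_def mult.assoc)

lemma L2_inner_self_nonneg: "0 \<le> L2_inner \<mu> f f"
  by (simp add: L2_inner_def)

lemma L2_inner_le_half_squares:
  assumes "f \<in> L2 \<mu>" "g \<in> L2 \<mu>"
  shows "2 * \<bar>L2_inner \<mu> f g\<bar> \<le> L2_inner \<mu> f f + L2_inner \<mu> g g"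
  using L2_inner_self_nonneg[of \<mu> "\<lambda>x. f x + g x"] L2_inner_self_nonneg[of \<mu> "\<lambda>x. f x - g x"] assms
  by (simp add: L2_inner_add_left L2_inner_add_right L2_inner_diff_left L2_inner_diff_right
      L2_add L2_diff L2_inner_commute[of \<mu> g f] abs_le_iff)

context prob_space
begin

lemma L2_const: "(\<lambda>_. c) \<in> L2 M"
  by (simp add: L2_def)

lemma L2_integrable:
  assumes "f \<in> L2 M" shows "integrable M f"
  using L2_integrable_mult[OF assms L2_const[of 1]] by simp

lemma L2_inner_const_right: "L2_inner M f (\<lambda>_. c) = c * (\<integral>x. f x \<partial>M)"
  by (simp add: L2_inner_def)

lemma var_wrt_eq_inner:
  assumes "f \<in> L2 M"
  shows "var_wrt M f = L2_inner M (\<lambda>x. f x - (\<integral>x. f x \<partial>M)) (\<lambda>x. f x - (\<integral>x. f x \<partial>M))"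
proof -
  define m where "m = (\<integral>x. f x \<partial>M)"
  have "L2_inner M (\<lambda>x. f x - m) (\<lambda>x. f x - m) = (\<integral>x. (f x)\<^sup>2 - 2 * m * f x + m\<^sup>2 \<partial>M)"
    unfolding L2_inner_def by (intro Bochner_Integration.integral_cong) (auto simp: power2_eq_square algebra_simps)
  also have "\<dots> = (\<integral>x. (f x)\<^sup>2 \<partial>M) - 2 * m * m + m\<^sup>2"
    using assms L2_integrable[OF assms] unfolding m_def by (simp add: L2D prob_space)
  finally show ?thesis by (simp add: var_wrt_def m_def power2_eq_square)
qed

lemma var_wrt_nonneg: "f \<in> L2 M \<Longrightarrow> 0 \<le> var_wrt M f"
  by (simp add: var_wrt_eq_inner L2_inner_self_nonneg)

lemma centred_L2: "f \<in> L2 M \<Longrightarrow> (\<lambda>x. f x - (\<integral>x. f x \<partial>M)) \<in> L2 M"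
  by (intro L2_diff L2_const)

lemma centred_L2_zero: "f \<in> L2 M \<Longrightarrow> (\<lambda>x. f x - (\<integral>x. f x \<partial>M)) \<in> L2_zero M"
  by (simp add: L2_zero_def centred_L2 L2_integrable prob_space)

text \<open>Jensen's inequality for the square, read off from the variance.\<close>

lemma square_integral_le:
  assumes "f \<in> L2 M" shows "(\<integral>x. f x \<partial>M)\<^sup>2 \<le> (\<integral>x. (f x)\<^sup>2 \<partial>M)"
  using var_wrt_nonneg[OF assms] by (simp add: var_wrt_def)

end

locale reversible_kernel = prob_space \<mu> for \<mu> :: "'a measure" +
  fixes K :: "'a \<Rightarrow> 'a measure"
  assumes kernel: "K \<in> \<mu> \<rightarrow>\<^sub>M prob_algebra \<mu>"
    and rev: "reversible \<mu> K"
begin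

abbreviation "J \<equiv> joint_law \<mu> \<mu> K"

lemmas sets_J [measurable_cong] = sets_joint_law[OF prob_space_axioms kernel]
lemmas Ksets = kernel_sets[OF prob_space_axioms kernel]
lemmas Kprob = kernel_prob[OF prob_space_axioms kernel]

lemma joint_law_symmetric: "distr J (\<mu> \<Otimes>\<^sub>M \<mu>) (\<lambda>z. (snd z, fst z)) = J"
proof (rule joint_law_eqI[OF prob_space_axioms kernel])
  fix A B assume AB: "A \<in> sets \<mu>" "B \<in> sets \<mu>"
  have "(\<lambda>z. (snd z, fst z)) -` (A \<times> B) \<inter> space J = B \<times> A"
    using AB[THEN sets.sets_into_space] by (auto simp: sets_eq_imp_space_eq[OF sets_J] space_pair_measure)
  then have "emeasure (distr J (\<mu> \<Otimes>\<^sub>M \<mu>) (\<lambda>z. (snd z, fst z))) (A \<times> B) = emeasure J (B \<times> A)"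
    using AB by (subst emeasure_distr) (auto simp: sets_J cong: measurable_cong_sets)
  also have "\<dots> = (\<integral>\<^sup>+x\<in>A. emeasure (K x) B \<partial>\<mu>)"
    using rev AB by (simp add: emeasure_joint_law_Times[OF prob_space_axioms kernel] reversible_def)
  finally show "emeasure (distr J (\<mu> \<Otimes>\<^sub>M \<mu>) (\<lambda>z. (snd z, fst z))) (A \<times> B) = (\<integral>\<^sup>+x\<in>A. emeasure (K x) B \<partial>\<mu>)" .
qed simp

lemma swap_measurable [measurable]: "(\<lambda>z. (snd z, fst z)) \<in> J \<rightarrow>\<^sub>M \<mu> \<Otimes>\<^sub>M \<mu>"
  by measurable

lemma integrable_J_swap:
  fixes F :: "'a \<times> 'a \<Rightarrow> real"
  assumes "integrable J F" shows "integrable J (\<lambda>z. F (snd z, fst z))"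
  using integrable_distr[OF swap_measurable, of F] assms
  by (simp add: joint_law_symmetric)

lemma integral_J_swap:
  fixes F :: "'a \<times> 'a \<Rightarrow> real"
  assumes "F \<in> borel_measurable (\<mu> \<Otimes>\<^sub>M \<mu>)" shows "(\<integral>z. F z \<partial>J) = (\<integral>z. F (snd z, fst z) \<partial>J)"
  using integral_distr[OF swap_measurable assms] by (simp add: joint_law_symmetric)

lemma integrable_J_fst:
  fixes h :: "'a \<Rightarrow> real"
  assumes h: "integrable \<mu> h"
  shows "integrable J (\<lambda>z. h (fst z))" and "(\<integral>z. h (fst z) \<partial>J) = (\<integral>x. h x \<partial>\<mu>)"
proof -
  have [measurable]: "h \<in> borel_measurable \<mu>" using h by auto
  have "(\<integral>\<^sup>+z. ennreal (norm (h (fst z))) \<partial>J) = (\<integral>\<^sup>+x. \<integral>\<^sup>+y. ennreal (norm (h x)) \<partial>K x \<partial>\<mu>)"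
    by (subst nn_integral_joint_law[OF prob_space_axioms kernel]) auto
  also have "\<dots> = (\<integral>\<^sup>+x. ennreal (norm (h x)) \<partial>\<mu>)"
    by (intro nn_integral_cong) (simp add: prob_space.emeasure_space_1[OF Kprob])
  also have "\<dots> < \<infinity>" using h by (simp add: integrable_iff_bounded)
  finally show I: "integrable J (\<lambda>z. h (fst z))"
    by (intro integrableI_bounded) auto
  show "(\<integral>z. h (fst z) \<partial>J) = (\<integral>x. h x \<partial>\<mu>)"
    unfolding integral_joint_law(3)[OF prob_space_axioms kernel I]
    by (intro Bochner_Integration.integral_cong) (simp_all add: prob_space.prob_space[OF Kprob])
qed

lemma integrable_J_snd:
  fixes h :: "'a \<Rightarrow> real"
  assumes h: "integrable \<mu> h"
  shows "integrable J (\<lambda>z. h (snd z))" and "(\<integral>z. h (snd z) \<partial>J) = (\<integral>x. h x \<partial>\<mu>)"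
proof -
  have [measurable]: "h \<in> borel_measurable \<mu>" using h by auto
  show "integrable J (\<lambda>z. h (snd z))"
    using integrable_J_swap[OF integrable_J_fst(1)[OF h]] by simp
  show "(\<integral>z. h (snd z) \<partial>J) = (\<integral>x. h x \<partial>\<mu>)"
    by (subst integral_J_swap) (simp_all add: integrable_J_fst(2)[OF h])
qed

lemma AE_integrable_kernel:
  fixes h :: "'a \<Rightarrow> real"
  assumes "integrable \<mu> h"
  shows "AE x in \<mu>. integrable (K x) h" and "integrable \<mu> (kernel_op K h)"
    and "(\<integral>x. kernel_op K h x \<partial>\<mu>) = (\<integral>x. h x \<partial>\<mu>)"
  using integral_joint_law[OF prob_space_axioms kernel integrable_J_snd(1)[OF assms]] integrable_J_snd(2)[OF assms]
  by (simp_all add: kernel_op_def[abs_def])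

lemma AE_kernel_L2:
  assumes "f \<in> L2 \<mu>" shows "AE x in \<mu>. f \<in> L2 (K x)"
  using AE_integrable_kernel(1)[OF L2D(2)[OF assms]] AE_space
  by eventually_elim (use L2D(1)[OF assms] Ksets in \<open>auto simp: L2_def cong: measurable_cong_sets\<close>)

lemma kernel_op_measurable:
  assumes [measurable]: "f \<in> borel_measurable \<mu>" shows "kernel_op K f \<in> borel_measurable \<mu>"
  unfolding kernel_op_def[abs_def]
  by (rule measurable_compose[OF measurable_prob_algebraD[OF kernel]]) measurable

text \<open>Jensen's inequality gives \<open>(K f)\<^sup>2 \<le> K (f\<^sup>2)\<close> almost everywhere, and \<open>K (f\<^sup>2)\<close> is integrable by stationarity.\<close>

lemma kernel_op_L2:
  assumes f: "f \<in> L2 \<mu>" shows "kernel_op K f \<in> L2 \<mu>"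
proof -
  note [measurable] = L2D(1)[OF f] kernel_op_measurable[OF L2D(1)[OF f]]
    kernel_op_measurable[OF borel_measurable_power[OF L2D(1)[OF f]]]
  have ae: "AE x in \<mu>. norm ((kernel_op K f x)\<^sup>2) \<le> norm (kernel_op K (\<lambda>x. (f x)\<^sup>2) x)"
    using AE_kernel_L2[OF f] AE_space
    by eventually_elim (simp add: kernel_op_def prob_space.square_integral_le[OF Kprob])
  have "integrable \<mu> (\<lambda>x. (kernel_op K f x)\<^sup>2)"
    by (rule Bochner_Integration.integrable_bound[OF AE_integrable_kernel(2)[OF L2D(2)[OF f]] _ ae]) simp
  then show ?thesis by (simp add: L2_def)
qed

lemma integrable_J_mult:
  assumes "f \<in> L2 \<mu>" "g \<in> L2 \<mu>"
  shows "integrable J (\<lambda>z. f (fst z) * g (snd z))"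
  using assms by (intro integrable_mult_of_squares integrable_J_fst integrable_J_snd) (auto dest: L2D)

text \<open>Inner products with \<open>K\<close> are integrals over the joint law, so bilinearity and symmetry hold without
  tracking the null sets on which \<open>f\<close> fails to be integrable under \<open>K x\<close>.\<close>

lemma inner_kernel_eq:
  assumes "f \<in> L2 \<mu>" "g \<in> L2 \<mu>"
  shows "L2_inner \<mu> f (kernel_op K g) = (\<integral>z. f (fst z) * g (snd z) \<partial>J)"
  using integral_joint_law(3)[OF prob_space_axioms kernel integrable_J_mult[OF assms]]
  by (simp add: L2_inner_def kernel_op_def)

lemma inner_kernel_symmetric:
  assumes "f \<in> L2 \<mu>" "g \<in> L2 \<mu>"
  shows "L2_inner \<mu> f (kernel_op K g) = L2_inner \<mu> (kernel_op K f) g"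
proof -
  have [measurable]: "f \<in> borel_measurable \<mu>" "g \<in> borel_measurable \<mu>" using assms by (auto dest: L2D)
  have "L2_inner \<mu> f (kernel_op K g) = (\<integral>z. f (snd z) * g (fst z) \<partial>J)"
    unfolding inner_kernel_eq[OF assms] by (subst integral_J_swap) auto
  then show ?thesis
    using inner_kernel_eq[OF assms(2,1)] by (simp add: mult.commute L2_inner_commute[of _ _ g])
qed

lemma inner_kernel_diff:
  assumes "f \<in> L2 \<mu>" "g \<in> L2 \<mu>" "h \<in> L2 \<mu>"
  shows "L2_inner \<mu> f (kernel_op K (\<lambda>x. g x - h x)) =
    L2_inner \<mu> f (kernel_op K g) - L2_inner \<mu> f (kernel_op K h)"
  using assms by (simp add: inner_kernel_symmetric L2_diff kernel_op_L2 L2_inner_diff_right)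

text \<open>The identities that bound \<open>\<langle>f, K f\<rangle>\<close> from both sides; the second is the usual formula for the Dirichlet form.\<close>

lemma sum_square_J:
  assumes f: "f \<in> L2 \<mu>"
  shows "(\<integral>z. (f (fst z) + f (snd z))\<^sup>2 \<partial>J) = 2 * (L2_inner \<mu> f f + L2_inner \<mu> f (kernel_op K f))"
    and "(\<integral>z. (f (fst z) - f (snd z))\<^sup>2 \<partial>J) = 2 * (L2_inner \<mu> f f - L2_inner \<mu> f (kernel_op K f))"
proof -
  note I = integrable_J_fst[OF L2D(2)[OF f]] integrable_J_snd[OF L2D(2)[OF f]] integrable_J_mult[OF f f]
  show "(\<integral>z. (f (fst z) + f (snd z))\<^sup>2 \<partial>J) = 2 * (L2_inner \<mu> f f + L2_inner \<mu> f (kernel_op K f))"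
    using I by (simp add: power2_sum mult.assoc inner_kernel_eq[OF f f]) (simp add: L2_inner_def power2_eq_square)
  show "(\<integral>z. (f (fst z) - f (snd z))\<^sup>2 \<partial>J) = 2 * (L2_inner \<mu> f f - L2_inner \<mu> f (kernel_op K f))"
    using I by (simp add: power2_diff mult.assoc inner_kernel_eq[OF f f]) (simp add: L2_inner_def power2_eq_square)
qed

lemma inner_kernel_bound:
  assumes "f \<in> L2 \<mu>"
  shows "\<bar>L2_inner \<mu> f (kernel_op K f)\<bar> \<le> L2_inner \<mu> f f"
proof -
  have "0 \<le> (\<integral>z. (f (fst z) + f (snd z))\<^sup>2 \<partial>J)" "0 \<le> (\<integral>z. (f (fst z) - f (snd z))\<^sup>2 \<partial>J)"
    by (auto intro: integral_nonneg)
  then show ?thesis using sum_square_J[OF assms] by (auto simp: abs_le_iff)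
qed

lemma kernel_contraction:
  assumes f: "f \<in> L2 \<mu>"
  shows "L2_inner \<mu> (kernel_op K f) (kernel_op K f) \<le> L2_inner \<mu> f f"
proof -
  let ?Kf = "kernel_op K f"
  note Kf = kernel_op_L2[OF f]
  have "(\<integral>x. (?Kf x)\<^sup>2 \<partial>\<mu>) \<le> (\<integral>x. kernel_op K (\<lambda>x. (f x)\<^sup>2) x \<partial>\<mu>)"
  proof (rule integral_mono_AE[OF L2D(2)[OF Kf] AE_integrable_kernel(2)[OF L2D(2)[OF f]]])
    show "AE x in \<mu>. (?Kf x)\<^sup>2 \<le> kernel_op K (\<lambda>x. (f x)\<^sup>2) x"
      using AE_kernel_L2[OF f] AE_space
      by eventually_elim (simp add: kernel_op_def prob_space.square_integral_le[OF Kprob])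
  qed
  then show ?thesis
    using AE_integrable_kernel(3)[OF L2D(2)[OF f]] by (simp add: L2_inner_def power2_eq_square)
qed

lemma dirichlet_eq:
  assumes "f \<in> L2 \<mu>"
  shows "dirichlet \<mu> K f = L2_inner \<mu> f f - L2_inner \<mu> f (kernel_op K f)"
  unfolding dirichlet_def using assms by (intro L2_inner_diff_right kernel_op_L2)

lemma dirichlet_nonneg: "f \<in> L2 \<mu> \<Longrightarrow> 0 \<le> dirichlet \<mu> K f"
  using inner_kernel_bound[of f] by (simp add: dirichlet_eq)

lemma dirichlet_minus_const:
  assumes f: "f \<in> L2 \<mu>"
  shows "dirichlet \<mu> K (\<lambda>x. f x - c) = dirichlet \<mu> K f"
  using f sum_square_J(2)[OF f] sum_square_J(2)[OF L2_diff[OF f L2_const[of c]]]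
  by (simp add: dirichlet_eq L2_diff L2_const)

end

section \<open>Resolvents as suprema of quadratic functionals\<close>

context reversible_kernel
begin

definition iter :: "('a \<Rightarrow> real) \<Rightarrow> nat \<Rightarrow> 'a \<Rightarrow> real" where
  "iter f k = (kernel_op K ^^ k) f"

definition autocov :: "('a \<Rightarrow> real) \<Rightarrow> nat \<Rightarrow> real" where
  "autocov f k = L2_inner \<mu> f (iter f k)"

lemma iter_0 [simp]: "iter f 0 = f"
  and iter_Suc: "iter f (Suc k) = kernel_op K (iter f k)"
  by (simp_all add: iter_def)

lemma iter_L2: "f \<in> L2 \<mu> \<Longrightarrow> iter f k \<in> L2 \<mu>"
  by (induction k) (simp_all add: iter_Suc kernel_op_L2)

lemma inner_iter:
  assumes f: "f \<in> L2 \<mu>"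
  shows "L2_inner \<mu> (iter f i) (iter f j) = autocov f (i + j)"
proof (induction i arbitrary: j)
  case (Suc i)
  have "L2_inner \<mu> (iter f (Suc i)) (iter f j) = L2_inner \<mu> (iter f i) (iter f (Suc j))"
    using f by (simp add: iter_Suc inner_kernel_symmetric iter_L2)
  then show ?case using Suc by simp
qed (simp add: autocov_def)

text \<open>Self-adjointness moves half of the powers of \<open>K\<close> to the left factor, which turns even autocovariances into
  squared norms.\<close>

lemma paired_autocovariance_autocov:
  assumes f: "f \<in> L2 \<mu>"
  shows "paired_autocovariance (autocov f)"
proof
  fix m
  have split: "autocov f (2 * m) = L2_inner \<mu> (iter f m) (iter f m)"
    "autocov f (2 * m + 1) = L2_inner \<mu> (iter f m) (kernel_op K (iter f m))"
    "autocov f (2 * m + 2) = L2_inner \<mu> (iter f (Suc m)) (iter f (Suc m))" for m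
    using f by (simp_all add: inner_iter iter_Suc[symmetric] mult_2)
  note B = inner_kernel_bound[OF iter_L2[OF f]]
  show "0 \<le> autocov f (2 * m) + autocov f (2 * m + 1)"
    using B[of m] unfolding split by linarith
  show "0 \<le> autocov f (2 * m) + 2 * autocov f (2 * m + 1) + autocov f (2 * m + 2)"
    using L2_inner_le_half_squares[OF iter_L2[OF f] iter_L2[OF f], of m "Suc m"]
    unfolding split iter_Suc[symmetric] by linarith
  have E: "autocov f (2 * m) \<le> autocov f 0" for m
  proof (induction m)
    case (Suc m)
    then show ?case
      using kernel_contraction[OF iter_L2[OF f], of m] split(3)[of m] split(1)[of m]
      by (simp add: iter_Suc[symmetric])
  qed simp
  fix k
  show "\<bar>autocov f k\<bar> \<le> autocov f 0"
  proof (cases "even k")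
    case True
    then obtain m where "k = 2 * m" by blast
    then show ?thesis using E[of m] split(1)[of m] L2_inner_self_nonneg[of \<mu> "iter f m"] by simp
  next
    case False
    then obtain m where "k = 2 * m + 1" by (rule oddE)
    then show ?thesis using E[of m] B[of m] split by simp
  qed
qed

text \<open>The quadratic form \<open>\<langle>g, (I - l K) g\<rangle>\<close>.\<close>

definition resolvent_form :: "real \<Rightarrow> ('a \<Rightarrow> real) \<Rightarrow> real" where
  "resolvent_form l g = L2_inner \<mu> g g - l * L2_inner \<mu> g (kernel_op K g)"

text \<open>A truncation of \<open>(I - l K)\<^sup>-\<^sup>1 f = (\<Sum>k. l\<^sup>k K\<^sup>k f)\<close>. Finite sums stay among actual functions, and the truncation
  error is of order \<open>l\<^sup>N\<close>.\<close>

definition neumann_sum :: "real \<Rightarrow> ('a \<Rightarrow> real) \<Rightarrow> nat \<Rightarrow> 'a \<Rightarrow> real" where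
  "neumann_sum l f N x = (\<Sum>k<N. l ^ k * iter f k x)"

lemma neumann_sum_L2: "f \<in> L2 \<mu> \<Longrightarrow> neumann_sum l f N \<in> L2 \<mu>"
  unfolding neumann_sum_def[abs_def] by (intro L2_sum L2_scale iter_L2)

lemma inner_neumann_sum:
  assumes f: "f \<in> L2 \<mu>" and h: "h \<in> L2 \<mu>"
  shows "L2_inner \<mu> h (neumann_sum l f N) = (\<Sum>k<N. l ^ k * L2_inner \<mu> h (iter f k))"
proof (induction N)
  case (Suc N)
  have "neumann_sum l f (Suc N) = (\<lambda>x. neumann_sum l f N x + l ^ N * iter f N x)"
    by (simp add: neumann_sum_def fun_eq_iff)
  then show ?case
    using Suc f h by (simp add: L2_inner_add_right neumann_sum_L2 L2_scale iter_L2 L2_inner_scale_right)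
qed (simp add: neumann_sum_def[abs_def] L2_inner_def)

text \<open>Telescoping: \<open>(I - l K)\<close> applied to the truncated series leaves \<open>f - l\<^sup>N K\<^sup>N f\<close>.\<close>

lemma neumann_sum_resolvent:
  assumes f: "f \<in> L2 \<mu>" and h: "h \<in> L2 \<mu>"
  shows "L2_inner \<mu> h (neumann_sum l f N) - l * L2_inner \<mu> h (kernel_op K (neumann_sum l f N))
    = L2_inner \<mu> h f - l ^ N * L2_inner \<mu> h (iter f N)"
proof -
  have "l * L2_inner \<mu> h (kernel_op K (neumann_sum l f N)) = (\<Sum>k<N. l ^ Suc k * L2_inner \<mu> h (iter f (Suc k)))"
    using f h
    by (simp add: inner_kernel_symmetric neumann_sum_L2 inner_neumann_sum kernel_op_L2 iter_L2 iter_Suc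
        sum_distrib_left mult.assoc)
  then have "L2_inner \<mu> h (neumann_sum l f N) - l * L2_inner \<mu> h (kernel_op K (neumann_sum l f N))
    = (\<Sum>k<N. l ^ k * L2_inner \<mu> h (iter f k) - l ^ Suc k * L2_inner \<mu> h (iter f (Suc k)))"
    using f h by (simp add: inner_neumann_sum sum_subtractf)
  also have "\<dots> = L2_inner \<mu> h f - l ^ N * L2_inner \<mu> h (iter f N)"
    by (subst sum_lessThan_telescope') simp
  finally show ?thesis .
qed

lemma resolvent_form_diff:
  assumes g: "g \<in> L2 \<mu>" and h: "h \<in> L2 \<mu>"
  shows "resolvent_form l (\<lambda>x. g x - h x) = resolvent_form l g + resolvent_form l h
    - 2 * (L2_inner \<mu> g h - l * L2_inner \<mu> g (kernel_op K h))"
  using g h inner_kernel_symmetric[OF g h]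
  by (simp add: resolvent_form_def L2_inner_diff_left L2_inner_diff_right inner_kernel_diff L2_diff
      kernel_op_L2 L2_inner_commute[of \<mu> h g] L2_inner_commute[of \<mu> h "kernel_op K g"] algebra_simps)

lemma resolvent_form_nonneg:
  assumes "g \<in> L2 \<mu>" "0 \<le> l" "l \<le> 1" shows "0 \<le> resolvent_form l g"
proof -
  have "l * L2_inner \<mu> g (kernel_op K g) \<le> l * L2_inner \<mu> g g"
    using inner_kernel_bound[OF assms(1)] assms by (intro mult_left_mono) auto
  also have "\<dots> \<le> L2_inner \<mu> g g"
    using assms by (intro mult_left_le_one_le L2_inner_self_nonneg) auto
  finally show ?thesis by (simp add: resolvent_form_def)
qed

text \<open>The value \<open>\<langle>f, (I - l K)\<^sup>-\<^sup>1 f\<rangle>\<close>.\<close>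

definition abel_autocov :: "real \<Rightarrow> ('a \<Rightarrow> real) \<Rightarrow> real" where
  "abel_autocov l f = paired_autocovariance.abel_sum (autocov f) l"

lemma inner_neumann_limit:
  assumes f: "f \<in> L2 \<mu>" and l: "0 \<le> l" "l < 1"
  shows "(\<lambda>N. L2_inner \<mu> f (neumann_sum l f N)) \<longlonglongrightarrow> abel_autocov l f"
proof -
  interpret paired_autocovariance "autocov f" by (rule paired_autocovariance_autocov[OF f])
  show ?thesis
    using summable_LIMSEQ[OF summable_abel[OF l, of 0]]
    by (simp add: inner_neumann_sum[OF f f] abel_autocov_def abel_sum_def autocov_def)
qed

lemma geometric_times_bounded_tendsto_0:
  fixes x :: "nat \<Rightarrow> real"
  assumes l: "0 \<le> l" "l < 1" and B: "\<And>N. \<bar>x N\<bar> \<le> B"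
  shows "(\<lambda>N. l ^ N * x N) \<longlonglongrightarrow> 0"
proof (rule tendsto_rabs_zero_cancel, rule tendsto_sandwich[of "\<lambda>_. 0"])
  show "(\<lambda>N. l ^ N * B) \<longlonglongrightarrow> 0"
    using l by (intro tendsto_mult_left_zero LIMSEQ_power_zero) auto
  show "\<forall>\<^sub>F N in sequentially. \<bar>l ^ N * x N\<bar> \<le> l ^ N * B"
    using l B by (intro always_eventually) (auto simp: abs_mult intro!: mult_left_mono)
qed auto

lemma inner_iter_bound:
  assumes f: "f \<in> L2 \<mu>" and g: "g \<in> L2 \<mu>"
  shows "\<bar>L2_inner \<mu> g (iter f N)\<bar> \<le> L2_inner \<mu> f f + L2_inner \<mu> g g"
proof -
  interpret paired_autocovariance "autocov f" by (rule paired_autocovariance_autocov[OF f])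
  have "L2_inner \<mu> (iter f N) (iter f N) \<le> L2_inner \<mu> f f"
    using bounded[of "N + N"] f by (simp add: inner_iter autocov_def)
  then show ?thesis
    using L2_inner_le_half_squares[OF g iter_L2[OF f], of N] L2_inner_self_nonneg[of \<mu> f] L2_inner_self_nonneg[of \<mu> g]
    by linarith
qed

lemma inner_iter_neumann_bound:
  assumes f: "f \<in> L2 \<mu>" and l: "0 \<le> l" "l < 1"
  shows "\<bar>L2_inner \<mu> (iter f N) (neumann_sum l f N)\<bar> \<le> autocov f 0 / (1 - l)"
proof -
  interpret paired_autocovariance "autocov f" by (rule paired_autocovariance_autocov[OF f])
  have "\<bar>L2_inner \<mu> (iter f N) (neumann_sum l f N)\<bar> \<le> (\<Sum>k<N. l ^ k * autocov f 0)"
    unfolding inner_neumann_sum[OF f iter_L2[OF f]] inner_iter[OF f]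
    using l bounded by (intro sum_abs[THEN order_trans] sum_mono) (auto simp: abs_mult intro!: mult_left_mono)
  also have "\<dots> = (\<Sum>k<N. l ^ k) * autocov f 0" by (simp add: sum_distrib_right)
  also have "\<dots> \<le> (1 / (1 - l)) * autocov f 0"
  proof (rule mult_right_mono[OF _ a0_nonneg])
    have "(\<Sum>k<N. l ^ k) = (1 - l ^ N) / (1 - l)" using l by (simp add: sum_gp_strict)
    also have "\<dots> \<le> 1 / (1 - l)" using l by (intro divide_right_mono) auto
    finally show "(\<Sum>k<N. l ^ k) \<le> 1 / (1 - l)" .
  qed
  finally show ?thesis by simp
qed

lemma resolvent_form_neumann:
  assumes f: "f \<in> L2 \<mu>"
  shows "resolvent_form l (neumann_sum l f N)
    = L2_inner \<mu> f (neumann_sum l f N) - l ^ N * L2_inner \<mu> (iter f N) (neumann_sum l f N)"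
  unfolding resolvent_form_def
  using f by (subst neumann_sum_resolvent) (simp_all add: neumann_sum_L2 L2_inner_commute)

text \<open>Completing the square: \<open>\<langle>g - h, (I - l K) (g - h)\<rangle> \<ge> 0\<close> with \<open>h\<close> the Neumann sum, up to errors that vanish as the
  truncation is removed.\<close>

lemma resolvent_lower:
  assumes f: "f \<in> L2 \<mu>" and g: "g \<in> L2 \<mu>" and l: "0 \<le> l" "l < 1"
  shows "2 * L2_inner \<mu> f g - resolvent_form l g \<le> abel_autocov l f"
proof (rule LIMSEQ_le_const)
  let ?g = "neumann_sum l f"
  let ?r = "\<lambda>N. L2_inner \<mu> f (?g N) + 2 * (l ^ N * L2_inner \<mu> g (iter f N)) - l ^ N * L2_inner \<mu> (iter f N) (?g N)"
  show "\<exists>N. \<forall>n\<ge>N. 2 * L2_inner \<mu> f g - resolvent_form l g \<le> ?r n"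
  proof (intro exI allI impI)
    fix N
    have "0 \<le> resolvent_form l (\<lambda>x. g x - ?g N x)"
      using f g l by (intro resolvent_form_nonneg L2_diff neumann_sum_L2) auto
    also have "\<dots> = resolvent_form l g + resolvent_form l (?g N) - 2 * (L2_inner \<mu> g f - l ^ N * L2_inner \<mu> g (iter f N))"
      using f g by (simp add: resolvent_form_diff neumann_sum_L2 neumann_sum_resolvent)
    finally show "2 * L2_inner \<mu> f g - resolvent_form l g \<le> ?r N"
      unfolding resolvent_form_neumann[OF f] by (simp add: L2_inner_commute[of \<mu> g f] algebra_simps)
  qed
  have "?r \<longlonglongrightarrow> abel_autocov l f + 2 * 0 - 0"
    by (intro tendsto_intros inner_neumann_limit[OF f l]
        geometric_times_bounded_tendsto_0[OF l inner_iter_bound[OF f g]]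
        geometric_times_bounded_tendsto_0[OF l inner_iter_neumann_bound[OF f l]])
  then show "?r \<longlonglongrightarrow> abel_autocov l f" by simp
qed

lemma resolvent_attained:
  assumes f: "f \<in> L2 \<mu>" and l: "0 \<le> l" "l < 1"
  shows "(\<lambda>N. 2 * L2_inner \<mu> f (neumann_sum l f N) - resolvent_form l (neumann_sum l f N)) \<longlonglongrightarrow> abel_autocov l f"
proof -
  have "(\<lambda>N. L2_inner \<mu> f (neumann_sum l f N) + l ^ N * L2_inner \<mu> (iter f N) (neumann_sum l f N))
      \<longlonglongrightarrow> abel_autocov l f + 0"
    by (intro tendsto_intros inner_neumann_limit[OF f l]
        geometric_times_bounded_tendsto_0[OF l inner_iter_neumann_bound[OF f l]])
  then show ?thesis by (simp add: resolvent_form_neumann[OF f])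
qed

lemma resolvent_form_dirichlet:
  "g \<in> L2 \<mu> \<Longrightarrow> resolvent_form l g = (1 - l) * L2_inner \<mu> g g + l * dirichlet \<mu> K g"
  by (simp add: resolvent_form_def dirichlet_eq algebra_simps)

lemma resolvent_form_scale: "g \<in> L2 \<mu> \<Longrightarrow> resolvent_form l (\<lambda>x. c * g x) = c\<^sup>2 * resolvent_form l g"
proof -
  have "kernel_op K (\<lambda>x. c * g x) = (\<lambda>x. c * kernel_op K g x)"
    by (simp add: kernel_op_def fun_eq_iff)
  then show ?thesis
    by (simp add: resolvent_form_def L2_inner_scale_left L2_inner_scale_right power2_eq_square algebra_simps)
qed

end

text \<open>If \<open>\<E>\<^bsub>K1\<^esub> \<le> c \<E>\<^bsub>K2\<^esub>\<close>, then \<open>\<delta>\<^sub>1 I + (I - K1) \<le> c (\<delta>\<^sub>2 I + (I - K2))\<close> as soon as \<open>\<delta>\<^sub>1 = c \<delta>\<^sub>2\<close>. Since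
  \<open>I - l K = l (\<delta> I + (I - K))\<close> with \<open>\<delta> = 1 / l - 1\<close>, this fixes the relation between \<open>l1\<close> and \<open>l2\<close>; a common
  value would fail for \<open>c < 1\<close>. The suprema of the two functionals are then ordered the opposite way.\<close>

lemma abel_autocov_compare:
  assumes R1: "reversible_kernel \<mu> K1" and R2: "reversible_kernel \<mu> K2" and f: "f \<in> L2 \<mu>"
    and le: "\<And>g. g \<in> L2 \<mu> \<Longrightarrow> dirichlet \<mu> K1 g \<le> c * dirichlet \<mu> K2 g"
    and c: "0 < c" and l: "0 < l1" "l1 < 1" "0 < l2" "l2 < 1" and eq: "1 / l1 - 1 = c * (1 / l2 - 1)"
  shows "reversible_kernel.abel_autocov \<mu> K2 l2 f \<le> c * l1 / l2 * reversible_kernel.abel_autocov \<mu> K1 l1 f"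
proof -
  interpret R1: reversible_kernel \<mu> K1 by (rule R1)
  interpret R2: reversible_kernel \<mu> K2 by (rule R2)
  define d where "d = c * l1 / l2"
  have d: "0 < d" using c l by (simp add: d_def)
  have form: "R1.resolvent_form l1 g \<le> d * R2.resolvent_form l2 g" if g: "g \<in> L2 \<mu>" for g
  proof -
    have e: "1 - l1 = d * (1 - l2)"
    proof -
      have "1 - l1 = l1 * (1 / l1 - 1)" using l by (simp add: field_simps)
      also have "\<dots> = d * (1 - l2)" unfolding eq d_def using l by (simp add: field_simps)
      finally show ?thesis .
    qed
    have "l1 * dirichlet \<mu> K1 g \<le> l1 * (c * dirichlet \<mu> K2 g)"
      using le[OF g] l by (intro mult_left_mono) auto
    also have "\<dots> = d * (l2 * dirichlet \<mu> K2 g)" using l by (simp add: d_def)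
    finally show ?thesis
      unfolding R1.resolvent_form_dirichlet[OF g] R2.resolvent_form_dirichlet[OF g] e
      by (simp add: algebra_simps)
  qed
  have "R2.abel_autocov l2 f \<le> d * R1.abel_autocov l1 f"
  proof (rule LIMSEQ_le_const2[OF R2.resolvent_attained[OF f]])
    show "\<exists>N. \<forall>n\<ge>N. 2 * L2_inner \<mu> f (R2.neumann_sum l2 f n) - R2.resolvent_form l2 (R2.neumann_sum l2 f n)
        \<le> d * R1.abel_autocov l1 f"
    proof (intro exI allI impI)
      fix n
      let ?g = "R2.neumann_sum l2 f n"
      have g: "?g \<in> L2 \<mu>" by (rule R2.neumann_sum_L2[OF f])
      (* The test function is rescaled by 1 / d: this is the scale at which the supremum of
         2 <f, g> - d Q(g) is 1 / d times that of 2 <f, g> - Q(g). *)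
      have "(1 / d)\<^sup>2 * R1.resolvent_form l1 ?g \<le> (1 / d)\<^sup>2 * (d * R2.resolvent_form l2 ?g)"
        by (intro mult_left_mono form g) simp
      also have "\<dots> = (1 / d) * R2.resolvent_form l2 ?g"
        using d by (simp add: power2_eq_square)
      finally have "(1 / d) * (2 * L2_inner \<mu> f ?g - R2.resolvent_form l2 ?g)
          \<le> 2 * L2_inner \<mu> f (\<lambda>x. 1 / d * ?g x) - R1.resolvent_form l1 (\<lambda>x. 1 / d * ?g x)"
        unfolding L2_inner_scale_right R1.resolvent_form_scale[OF g] by (simp add: algebra_simps)
      also have "\<dots> \<le> R1.abel_autocov l1 f"
        using f g l by (intro R1.resolvent_lower L2_scale) auto
      finally show "2 * L2_inner \<mu> f ?g - R2.resolvent_form l2 ?g \<le> d * R1.abel_autocov l1 f"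
        using d by (simp add: field_simps)
    qed
  qed (use l in auto)
  then show ?thesis by (simp add: d_def)
qed

section \<open>Covariances and variances along the stationary chain\<close>

context reversible_kernel
begin

interpretation IT: Ionescu_Tulcea "chain_step \<mu> K" "\<lambda>_. \<mu>"
  by (rule Ionescu_Tulcea_chain_step[OF prob_space_axioms kernel])

abbreviation "law \<equiv> chain_law \<mu> K"

lemma law_eq: "law = IT.PF.lim"
  by (simp add: chain_law_def)

lemma sets_law [measurable_cong]: "sets law = sets (PiM UNIV (\<lambda>_. \<mu>))"
  by (simp add: law_eq)

lemma coordinate_measurable [measurable]: "(\<lambda>\<xi>. \<xi> n) \<in> law \<rightarrow>\<^sub>M \<mu>"
  by measurable

lemma coordinate_space: "\<xi> \<in> space law \<Longrightarrow> \<xi> n \<in> space \<mu>"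
  using measurable_space[OF coordinate_measurable] .

text \<open>The chain starts from the empty history; the function \<open>\<lambda>_. undefined\<close> is the only point of the empty product.\<close>

lemma distr_law_initial: "distr law (PiM {0..<n} (\<lambda>_. \<mu>)) (\<lambda>\<xi>. restrict \<xi> {0..<n}) = IT.C 0 n (\<lambda>_. undefined)"
proof -
  have u: "IT.up_to {0..<n} = n"
    unfolding IT.up_to_def by (rule Least_equality) (auto simp: not_less[symmetric])
  have "distr law (PiM {0..<n} (\<lambda>_. \<mu>)) (\<lambda>\<xi>. restrict \<xi> {0..<n}) = IT.CI {0..<n}"
    unfolding law_eq by (rule IT.distr_lim) simp
  also have "\<dots> = distr (IT.C 0 n (\<lambda>_. undefined)) (PiM {0..<0+n} (\<lambda>_. \<mu>)) (\<lambda>\<xi>. restrict \<xi> {0..<0+n})"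
    unfolding IT.CI_def u by simp
  also have "\<dots> = IT.C 0 n (\<lambda>_. undefined)"
    by (rule IT.distr_C[symmetric]) auto
  finally show ?thesis .
qed

lemma nn_integral_law_initial:
  assumes [measurable]: "G \<in> borel_measurable (PiM {0..<n} (\<lambda>_. \<mu>))"
  shows "(\<integral>\<^sup>+\<xi>. G (restrict \<xi> {0..<n}) \<partial>law) = (\<integral>\<^sup>+\<omega>. G \<omega> \<partial>IT.C 0 n (\<lambda>_. undefined))"
  unfolding distr_law_initial[symmetric]
  by (subst nn_integral_distr) (auto intro!: measurable_restrict_subset simp: sets_law cong: measurable_cong_sets)

lemma prob_space_initial: "prob_space (IT.C 0 n (\<lambda>_. undefined))"
  by (rule IT.prob_space_C) simp

lemma prob_space_law: "prob_space law"
  using nn_integral_law_initial[of "\<lambda>_. 1" 0] prob_space.emeasure_space_1[OF prob_space_initial[of 0]]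
  by (intro prob_spaceI) (simp del: IT.C.simps)

lemma nn_integral_C_Suc:
  assumes [measurable]: "G \<in> borel_measurable (PiM {0..<Suc n} (\<lambda>_. \<mu>))"
  shows "(\<integral>\<^sup>+\<omega>. G \<omega> \<partial>IT.C 0 (Suc n) (\<lambda>_. undefined))
    = (\<integral>\<^sup>+\<omega>. \<integral>\<^sup>+y. G (fun_upd \<omega> n y) \<partial>chain_step \<mu> K n \<omega> \<partial>IT.C 0 n (\<lambda>_. undefined))"
proof -
  have s: "sets (IT.C 0 n (\<lambda>_. undefined)) = sets (PiM {0..<n} (\<lambda>_. \<mu>))"
    using IT.sets_C[of "\<lambda>_. undefined" 0 n] by simp
  have "(\<integral>\<^sup>+\<omega>. G \<omega> \<partial>IT.C 0 (Suc n) (\<lambda>_. undefined))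
      = (\<integral>\<^sup>+\<omega>. \<integral>\<^sup>+z. G z \<partial>IT.eP n \<omega> \<partial>IT.C 0 n (\<lambda>_. undefined))"
    using IT.measurable_eP[of n] s
    by (simp add: nn_integral_bind[OF assms] cong: measurable_cong_sets)
  also have "\<dots> = (\<integral>\<^sup>+\<omega>. \<integral>\<^sup>+y. G (fun_upd \<omega> n y) \<partial>chain_step \<mu> K n \<omega> \<partial>IT.C 0 n (\<lambda>_. undefined))"
    by (intro nn_integral_cong IT.nn_integral_eP) (auto simp: sets_eq_imp_space_eq[OF s])
  finally show ?thesis .
qed

lemma nn_integral_law_start:
  assumes [measurable]: "g \<in> borel_measurable \<mu>"
  shows "(\<integral>\<^sup>+\<xi>. g (\<xi> 0) \<partial>law) = (\<integral>\<^sup>+x. g x \<partial>\<mu>)"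
proof -
  have "(\<integral>\<^sup>+\<xi>. g (\<xi> 0) \<partial>law) = (\<integral>\<^sup>+\<xi>. (\<lambda>\<omega>. g (\<omega> 0)) (restrict \<xi> {0..<Suc 0}) \<partial>law)"
    by simp
  also have "\<dots> = (\<integral>\<^sup>+\<omega>. \<integral>\<^sup>+y. g y \<partial>\<mu> \<partial>IT.C 0 0 (\<lambda>_. undefined))"
    by (subst nn_integral_law_initial, measurable, subst nn_integral_C_Suc) (simp_all add: chain_step_def)
  also have "\<dots> = (\<integral>\<^sup>+y. g y \<partial>\<mu>)"
    using prob_space.emeasure_space_1[OF prob_space_initial[of 0]] by (simp del: IT.C.simps)
  finally show ?thesis .
qed

text \<open>The Markov property of the Ionescu-Tulcea law, for one step and a function of one earlier coordinate.\<close>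

lemma nn_integral_law_step:
  assumes F [measurable]: "F \<in> borel_measurable (\<mu> \<Otimes>\<^sub>M \<mu>)" and ij: "i \<le> j"
  shows "(\<integral>\<^sup>+\<xi>. F (\<xi> i, \<xi> (Suc j)) \<partial>law) = (\<integral>\<^sup>+\<xi>. \<integral>\<^sup>+y. F (\<xi> i, y) \<partial>K (\<xi> j) \<partial>law)"
proof -
  let ?n = "Suc j"
  let ?H = "\<lambda>\<omega>. \<integral>\<^sup>+y. F (\<omega> i, y) \<partial>K (\<omega> j)"
  have coord: "(\<lambda>\<omega>. \<omega> k) \<in> PiM {0..<m} (\<lambda>_. \<mu>) \<rightarrow>\<^sub>M \<mu>" if "k < m" for k m :: nat
    using that by (intro measurable_component_singleton) auto
  have Kj: "(\<lambda>\<omega>. K (\<omega> j)) \<in> PiM {0..<?n} (\<lambda>_. \<mu>) \<rightarrow>\<^sub>M subprob_algebra \<mu>"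
    by (rule measurable_compose[OF coord measurable_prob_algebraD[OF kernel]]) simp
  have H [measurable]: "?H \<in> borel_measurable (PiM {0..<?n} (\<lambda>_. \<mu>))"
  proof (rule nn_integral_measurable_subprob_algebra2[OF _ Kj])
    have "(\<lambda>z. (fst z i, snd z)) \<in> PiM {0..<?n} (\<lambda>_. \<mu>) \<Otimes>\<^sub>M \<mu> \<rightarrow>\<^sub>M \<mu> \<Otimes>\<^sub>M \<mu>"
      by (intro measurable_Pair measurable_snd measurable_compose[OF measurable_fst coord]) (use ij in auto)
    from measurable_compose[OF this F]
    show "(\<lambda>(\<omega>, y). F (\<omega> i, y)) \<in> borel_measurable (PiM {0..<?n} (\<lambda>_. \<mu>) \<Otimes>\<^sub>M \<mu>)"
      by (simp add: case_prod_unfold)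
  qed
  have G [measurable]: "(\<lambda>\<omega>. F (\<omega> i, \<omega> ?n)) \<in> borel_measurable (PiM {0..<Suc ?n} (\<lambda>_. \<mu>))"
    by (intro measurable_compose[OF measurable_Pair F] coord) (use ij in auto)
  have "(\<integral>\<^sup>+\<xi>. F (\<xi> i, \<xi> ?n) \<partial>law) = (\<integral>\<^sup>+\<xi>. (\<lambda>\<omega>. F (\<omega> i, \<omega> ?n)) (restrict \<xi> {0..<Suc ?n}) \<partial>law)"
    using ij by simp
  also have "\<dots> = (\<integral>\<^sup>+\<omega>. F (\<omega> i, \<omega> ?n) \<partial>IT.C 0 (Suc ?n) (\<lambda>_. undefined))"
    by (rule nn_integral_law_initial[OF G])
  also have "\<dots> = (\<integral>\<^sup>+\<omega>. \<integral>\<^sup>+y. F (fun_upd \<omega> ?n y i, fun_upd \<omega> ?n y ?n) \<partial>chain_step \<mu> K ?n \<omega> \<partial>IT.C 0 ?n (\<lambda>_. undefined))"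
    by (rule nn_integral_C_Suc[OF G])
  also have "\<dots> = (\<integral>\<^sup>+\<omega>. ?H \<omega> \<partial>IT.C 0 ?n (\<lambda>_. undefined))"
    using ij by (simp add: chain_step_def)
  also have "\<dots> = (\<integral>\<^sup>+\<xi>. ?H (restrict \<xi> {0..<?n}) \<partial>law)"
    by (rule nn_integral_law_initial[OF H, symmetric])
  also have "\<dots> = (\<integral>\<^sup>+\<xi>. ?H \<xi> \<partial>law)"
    using ij by simp
  finally show ?thesis .
qed

lemma nn_integral_stationary:
  assumes "g \<in> borel_measurable \<mu>"
  shows "(\<integral>\<^sup>+\<xi>. g (\<xi> n) \<partial>law) = (\<integral>\<^sup>+x. g x \<partial>\<mu>)"
  using assms
proof (induction n arbitrary: g)
  case 0 then show ?case by (rule nn_integral_law_start)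
next
  case (Suc n)
  note [measurable] = Suc.prems
  have Kg: "(\<lambda>x. \<integral>\<^sup>+y. g y \<partial>K x) \<in> borel_measurable \<mu>"
    by (rule measurable_compose[OF measurable_prob_algebraD[OF kernel]]) measurable
  have "(\<integral>\<^sup>+\<xi>. g (\<xi> (Suc n)) \<partial>law) = (\<integral>\<^sup>+\<xi>. \<integral>\<^sup>+y. g y \<partial>K (\<xi> n) \<partial>law)"
    using nn_integral_law_step[of "\<lambda>z. g (snd z)" n n] by simp
  also have "\<dots> = (\<integral>\<^sup>+x. \<integral>\<^sup>+y. g y \<partial>K x \<partial>\<mu>)"
    by (rule Suc.IH[OF Kg])
  also have "\<dots> = (\<integral>\<^sup>+z. g (snd z) \<partial>J)"
    by (subst nn_integral_joint_law[OF prob_space_axioms kernel]) auto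
  also have "\<dots> = (\<integral>\<^sup>+z. g (snd z) \<partial>distr J (\<mu> \<Otimes>\<^sub>M \<mu>) (\<lambda>z. (snd z, fst z)))"
    by (simp add: joint_law_symmetric)
  also have "\<dots> = (\<integral>\<^sup>+z. g (fst z) \<partial>J)"
    by (subst nn_integral_distr) auto
  also have "\<dots> = (\<integral>\<^sup>+x. \<integral>\<^sup>+y. g x \<partial>K x \<partial>\<mu>)"
    by (subst nn_integral_joint_law[OF prob_space_axioms kernel]) auto
  also have "\<dots> = (\<integral>\<^sup>+x. g x \<partial>\<mu>)"
    by (intro nn_integral_cong) (simp add: prob_space.emeasure_space_1[OF Kprob])
  finally show ?case .
qed

lemma distr_coordinate: "distr law \<mu> (\<lambda>\<xi>. \<xi> n) = \<mu>"
proof (rule measure_eqI)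
  fix A assume "A \<in> sets (distr law \<mu> (\<lambda>\<xi>. \<xi> n))"
  then have [measurable]: "A \<in> sets \<mu>" by simp
  have "emeasure (distr law \<mu> (\<lambda>\<xi>. \<xi> n)) A = (\<integral>\<^sup>+x. indicator A x \<partial>distr law \<mu> (\<lambda>\<xi>. \<xi> n))"
    by simp
  also have "\<dots> = (\<integral>\<^sup>+\<xi>. indicator A (\<xi> n) \<partial>law)" 
    by (rule nn_integral_distr[OF coordinate_measurable[of n]], rule borel_measurable_indicator) simp
  also have "\<dots> = emeasure \<mu> A" by (subst nn_integral_stationary[of "indicator A" n]) auto
  finally show "emeasure (distr law \<mu> (\<lambda>\<xi>. \<xi> n)) A = emeasure \<mu> A" .
qed simp

lemma integral_stationary:
  fixes g :: "'a \<Rightarrow> real"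
  assumes g: "integrable \<mu> g"
  shows "integrable law (\<lambda>\<xi>. g (\<xi> n))" and "(\<integral>\<xi>. g (\<xi> n) \<partial>law) = (\<integral>x. g x \<partial>\<mu>)"
  using integrable_distr[OF coordinate_measurable[of n], of g] integral_distr[OF coordinate_measurable[of n], of g] g
  by (simp_all add: distr_coordinate)

lemma coordinate_L2: "f \<in> L2 \<mu> \<Longrightarrow> (\<lambda>\<xi>. f (\<xi> n)) \<in> L2 law"
  using integral_stationary(1)[of "\<lambda>x. (f x)\<^sup>2" n] by (auto simp: L2_def)

text \<open>The integrand \<open>f (\<xi> i) g (\<xi> (j + 1))\<close> is unbounded and signed; the nonnegative case identifies the law of the
  two coordinates as a mixture over the chain, to which Fubini for kernels applies.\<close>

lemma markov_property:
  assumes f: "f \<in> L2 \<mu>" and g: "g \<in> L2 \<mu>" and ij: "i \<le> j"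
  shows "L2_inner law (\<lambda>\<xi>. f (\<xi> i)) (\<lambda>\<xi>. g (\<xi> (Suc j))) = L2_inner law (\<lambda>\<xi>. f (\<xi> i)) (\<lambda>\<xi>. kernel_op K g (\<xi> j))"
proof -
  interpret law: prob_space law by (rule prob_space_law)
  let ?Q = "\<lambda>\<xi>. distr (K (\<xi> j)) (\<mu> \<Otimes>\<^sub>M \<mu>) (Pair (\<xi> i))"
  let ?F = "\<lambda>z. f (fst z) * g (snd z)"
  have [measurable]: "f \<in> borel_measurable \<mu>" "g \<in> borel_measurable \<mu>" using f g by (auto dest: L2D)
  have Kj: "(\<lambda>\<xi>. K (\<xi> j)) \<in> law \<rightarrow>\<^sub>M prob_algebra \<mu>"
    by (rule measurable_compose[OF coordinate_measurable kernel])
  have Q: "?Q \<in> law \<rightarrow>\<^sub>M prob_algebra (\<mu> \<Otimes>\<^sub>M \<mu>)"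
    by (rule measurable_distr_prob_space2[OF Kj]) measurable
  have P: "Pair (\<xi> i) \<in> K (\<xi> j) \<rightarrow>\<^sub>M \<mu> \<Otimes>\<^sub>M \<mu>" if "\<xi> \<in> space law" for \<xi>
    using coordinate_space[OF that] by (simp add: Ksets cong: measurable_cong_sets)
  have bind: "law \<bind> ?Q = distr law (\<mu> \<Otimes>\<^sub>M \<mu>) (\<lambda>\<xi>. (\<xi> i, \<xi> (Suc j)))"
  proof (rule measure_eqI)
    have s: "sets (law \<bind> ?Q) = sets (\<mu> \<Otimes>\<^sub>M \<mu>)"
      by (intro sets_bind'[OF _ Q]) (simp add: space_prob_algebra law.prob_space_axioms)
    then show "sets (law \<bind> ?Q) = sets (distr law (\<mu> \<Otimes>\<^sub>M \<mu>) (\<lambda>\<xi>. (\<xi> i, \<xi> (Suc j))))" by simp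
    fix A assume "A \<in> sets (law \<bind> ?Q)"
    then have A [measurable]: "A \<in> sets (\<mu> \<Otimes>\<^sub>M \<mu>)" using s by simp
    have "emeasure (law \<bind> ?Q) A = (\<integral>\<^sup>+z. indicator A z \<partial>(law \<bind> ?Q))"
      using s A by simp
    also have "\<dots> = (\<integral>\<^sup>+\<xi>. \<integral>\<^sup>+z. indicator A z \<partial>?Q \<xi> \<partial>law)"
      by (rule nn_integral_bind_kernel[OF refl Q]) measurable
    also have "\<dots> = (\<integral>\<^sup>+\<xi>. \<integral>\<^sup>+y. indicator A (\<xi> i, y) \<partial>K (\<xi> j) \<partial>law)"
      by (intro nn_integral_cong, rule nn_integral_distr[OF P]) auto
    also have "\<dots> = (\<integral>\<^sup>+\<xi>. indicator A (\<xi> i, \<xi> (Suc j)) \<partial>law)"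
      by (rule nn_integral_law_step[symmetric, OF _ ij]) measurable
    also have "\<dots> = (\<integral>\<^sup>+z. indicator A z \<partial>distr law (\<mu> \<Otimes>\<^sub>M \<mu>) (\<lambda>\<xi>. (\<xi> i, \<xi> (Suc j))))"
      by (rule nn_integral_distr[symmetric]) measurable
    finally show "emeasure (law \<bind> ?Q) A = emeasure (distr law (\<mu> \<Otimes>\<^sub>M \<mu>) (\<lambda>\<xi>. (\<xi> i, \<xi> (Suc j)))) A"
      by simp
  qed
  have int: "integrable (law \<bind> ?Q) ?F"
    unfolding bind
    by (subst integrable_distr_eq) (use f g in \<open>auto intro!: L2_integrable_mult coordinate_L2\<close>)
  have "L2_inner law (\<lambda>\<xi>. f (\<xi> i)) (\<lambda>\<xi>. g (\<xi> (Suc j))) = (\<integral>z. ?F z \<partial>(law \<bind> ?Q))"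
    unfolding bind L2_inner_def by (subst integral_distr) auto
  also have "\<dots> = (\<integral>\<xi>. \<integral>z. ?F z \<partial>?Q \<xi> \<partial>law)"
    by (rule integral_bind_kernel(3)[OF Q law.not_empty int])
  also have "\<dots> = L2_inner law (\<lambda>\<xi>. f (\<xi> i)) (\<lambda>\<xi>. kernel_op K g (\<xi> j))"
    unfolding L2_inner_def kernel_op_def
    by (intro Bochner_Integration.integral_cong refl, subst integral_distr[OF P]) auto
  finally show ?thesis .
qed

lemma autocovariance_law:
  assumes f: "f \<in> L2 \<mu>" and g: "g \<in> L2 \<mu>"
  shows "L2_inner law (\<lambda>\<xi>. f (\<xi> i)) (\<lambda>\<xi>. g (\<xi> (i + k))) = L2_inner \<mu> f (iter g k)"
  using g
proof (induction k arbitrary: g)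
  case 0
  then show ?case
    using integral_stationary(2)[OF L2_integrable_mult[OF f 0]] by (simp add: L2_inner_def)
next
  case (Suc k)
  have "iter (kernel_op K g) k = iter g (Suc k)"
    by (simp add: iter_def funpow_swap1)
  then show ?case
    using markov_property[OF f Suc.prems, of i "i + k"] Suc.IH[OF kernel_op_L2[OF Suc.prems]] by simp
qed

definition partial_sum :: "('a \<Rightarrow> real) \<Rightarrow> nat \<Rightarrow> (nat \<Rightarrow> 'a) \<Rightarrow> real" where
  "partial_sum f M \<xi> = (\<Sum>i<M. f (\<xi> i))"

lemma partial_sum_L2: "f \<in> L2 \<mu> \<Longrightarrow> partial_sum f M \<in> L2 law"
  unfolding partial_sum_def[abs_def] by (intro L2_sum coordinate_L2)

lemma inner_partial_sum:
  assumes "f \<in> L2 \<mu>" "h \<in> L2 law"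
  shows "L2_inner law (partial_sum f M) h = (\<Sum>i<M. L2_inner law (\<lambda>\<xi>. f (\<xi> i)) h)"
proof (induction M)
  case (Suc M)
  have "partial_sum f (Suc M) = (\<lambda>\<xi>. partial_sum f M \<xi> + f (\<xi> M))"
    by (simp add: partial_sum_def fun_eq_iff)
  then show ?case
    using Suc assms by (simp add: L2_inner_add_left partial_sum_L2 coordinate_L2)
qed (simp add: partial_sum_def[abs_def] L2_inner_def)

lemma second_moment_partial_sum:
  assumes f: "f \<in> L2 \<mu>"
  shows "L2_inner law (partial_sum f M) (partial_sum f M)
    = real M * paired_autocovariance.partial_variance (autocov f) M"
proof -
  interpret paired_autocovariance "autocov f" by (rule paired_autocovariance_autocov[OF f])
  have "L2_inner law (partial_sum f M) (partial_sum f M) = (\<Sum>n<M. trapezoid n + autocov f n)"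
  proof (induction M)
    case (Suc M)
    have cross: "L2_inner law (partial_sum f M) (\<lambda>\<xi>. f (\<xi> M)) = (\<Sum>k<M. autocov f (Suc k))"
    proof -
      have "L2_inner law (partial_sum f M) (\<lambda>\<xi>. f (\<xi> M)) = (\<Sum>i<M. autocov f (M - i))"
        unfolding inner_partial_sum[OF f coordinate_L2[OF f]]
      proof (intro sum.cong refl)
        fix i assume "i \<in> {..<M}"
        then show "L2_inner law (\<lambda>\<xi>. f (\<xi> i)) (\<lambda>\<xi>. f (\<xi> M)) = autocov f (M - i)"
          using autocovariance_law[OF f f, of i "M - i"] by (simp add: autocov_def)
      qed
      also have "\<dots> = (\<Sum>k<M. autocov f (Suc k))"
        by (rule sum.reindex_bij_witness[of _ "\<lambda>k. M - Suc k" "\<lambda>i. M - Suc i"]) (auto simp: Suc_diff_Suc)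
      finally show ?thesis .
    qed
    have diag: "L2_inner law (\<lambda>\<xi>. f (\<xi> M)) (\<lambda>\<xi>. f (\<xi> M)) = autocov f 0"
      using autocovariance_law[OF f f, of M 0] by (simp add: autocov_def)
    have "partial_sum f (Suc M) = (\<lambda>\<xi>. partial_sum f M \<xi> + f (\<xi> M))"
      by (simp add: partial_sum_def fun_eq_iff)
    then have "L2_inner law (partial_sum f (Suc M)) (partial_sum f (Suc M))
        = L2_inner law (partial_sum f M) (partial_sum f M)
          + 2 * L2_inner law (partial_sum f M) (\<lambda>\<xi>. f (\<xi> M)) + L2_inner law (\<lambda>\<xi>. f (\<xi> M)) (\<lambda>\<xi>. f (\<xi> M))"
      using f by (simp add: L2_inner_add_left L2_inner_add_right L2_add partial_sum_L2 coordinate_L2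
          L2_inner_commute[of law "\<lambda>\<xi>. f (\<xi> M)" "partial_sum f M"])
    then show ?case using Suc cross diag trapezoid_add[of M] by simp
  qed (simp add: partial_sum_def[abs_def] L2_inner_def)
  then show ?thesis by (cases "M = 0") (auto simp: partial_variance_def)
qed

lemma var_scaled_partial_sum:
  assumes f: "f \<in> L2_zero \<mu>" and M: "M > 0"
  shows "var_wrt law (\<lambda>\<xi>. 1 / sqrt (real M) * (\<Sum>i<M. f (\<xi> i)))
    = paired_autocovariance.partial_variance (autocov f) M"
proof -
  interpret law: prob_space law by (rule prob_space_law)
  have f2: "f \<in> L2 \<mu>" and f0: "(\<integral>x. f x \<partial>\<mu>) = 0" using f by (auto simp: L2_zero_def)
  have "(\<integral>\<xi>. (\<Sum>i<M. f (\<xi> i)) \<partial>law) = 0"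
    using integral_stationary[OF L2_integrable[OF f2]] f0 by (subst Bochner_Integration.integral_sum) auto
  moreover have "(\<integral>\<xi>. (\<Sum>i<M. f (\<xi> i))\<^sup>2 \<partial>law) = real M * paired_autocovariance.partial_variance (autocov f) M"
    using second_moment_partial_sum[OF f2, of M] by (simp add: L2_inner_def partial_sum_def power2_eq_square)
  ultimately show ?thesis
    using M by (simp add: var_wrt_def power_mult_distrib power_divide)
qed

text \<open>Along the chain the normalised variances are the Cesaro means of the autocovariances of the centred
  function, so the limit in the definition of \<open>asym_var\<close> exists and equals the limit of the Abel sums up to
  the affine change of \<open>cesaro_abel\<close>.\<close>

lemma asym_var_abel:
  assumes f: "f \<in> L2 \<mu>"
  defines "f0 \<equiv> \<lambda>x. f x - (\<integral>x. f x \<partial>\<mu>)"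
  shows "(\<lambda>M. ereal (paired_autocovariance.partial_variance (autocov f0) M)) \<longlonglongrightarrow> asym_var \<mu> K f"
    and "((\<lambda>l. ereal (abel_autocov l f0)) \<longlongrightarrow> (asym_var \<mu> K f + ereal (var_wrt \<mu> f)) / 2) (at_left 1)"
proof -
  have f0: "f0 \<in> L2_zero \<mu>" unfolding f0_def by (rule centred_L2_zero[OF f])
  then have f02: "f0 \<in> L2 \<mu>" by (simp add: L2_zero_def)
  interpret paired_autocovariance "autocov f0" by (rule paired_autocovariance_autocov[OF f02])
  obtain L where L: "(\<lambda>M. ereal (partial_variance M)) \<longlonglongrightarrow> L"
    "((\<lambda>l. ereal (abel_sum l)) \<longlongrightarrow> (L + ereal (autocov f0 0)) / 2) (at_left 1)"
    by (rule cesaro_abel)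
  have "(\<lambda>M. ereal (var_wrt law (\<lambda>\<xi>. 1 / sqrt (real M) * (\<Sum>i<M. f0 (\<xi> i))))) \<longlonglongrightarrow> L"
    using L(1)
    by (rule Lim_transform_eventually)
      (use eventually_gt_at_top[of 0] in \<open>eventually_elim, simp only: var_scaled_partial_sum[OF f0]\<close>)
  then have "asym_var \<mu> K f = L"
    unfolding asym_var_def f0_def by (rule limI)
  moreover have "autocov f0 0 = var_wrt \<mu> f"
    using var_wrt_eq_inner[OF f] by (simp add: autocov_def f0_def)
  ultimately show "(\<lambda>M. ereal (partial_variance M)) \<longlonglongrightarrow> asym_var \<mu> K f"
    "((\<lambda>l. ereal (abel_autocov l f0)) \<longlongrightarrow> (asym_var \<mu> K f + ereal (var_wrt \<mu> f)) / 2) (at_left 1)"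
    using L by (simp_all add: abel_autocov_def)
qed

end

section \<open>Comparison of asymptotic variances\<close>

context reversible_kernel
begin

lemma asym_var_nonneg: assumes f: "f \<in> L2 \<mu>" shows "0 \<le> asym_var \<mu> K f"
proof (rule LIMSEQ_le_const[OF asym_var_abel(1)[OF f]])
  let ?f = "\<lambda>x. f x - (\<integral>x. f x \<partial>\<mu>)"
  have "0 \<le> paired_autocovariance.partial_variance (autocov ?f) M" if "M > 0" for M
    using that second_moment_partial_sum[OF centred_L2[OF f], of M]
      L2_inner_self_nonneg[of law "partial_sum ?f M"] by (simp add: zero_le_mult_iff)
  then show "\<exists>N. \<forall>M\<ge>N. 0 \<le> ereal (paired_autocovariance.partial_variance (autocov ?f) M)"
    by (intro exI[of _ 1]) auto
qed

lemma var_le_asym_var: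
  assumes pos: "positive_kernel \<mu> K" and f: "f \<in> L2 \<mu>"
  shows "ereal (var_wrt \<mu> f) \<le> asym_var \<mu> K f"
proof (rule LIMSEQ_le_const[OF asym_var_abel(1)[OF f]])
  let ?f = "\<lambda>x. f x - (\<integral>x. f x \<partial>\<mu>)"
  note f0 = centred_L2[OF f]
  interpret paired_autocovariance "autocov ?f" by (rule paired_autocovariance_autocov[OF f0])
  have "0 \<le> autocov ?f k" for k
  proof (cases "even k")
    case True
    then obtain m where "k = m + m" by (auto simp: mult_2 elim!: evenE)
    then show ?thesis using inner_iter[OF f0, of m m] L2_inner_self_nonneg[of \<mu> "iter ?f m"] by simp
  next
    case False
    then obtain m where "k = m + Suc m" by (auto simp: mult_2 elim!: oddE)
    then show ?thesis
      using inner_iter[OF f0, of m "Suc m", symmetric] pos iter_L2[OF f0, of m]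
      by (simp add: positive_kernel_def iter_Suc)
  qed
  moreover have "autocov ?f 0 = var_wrt \<mu> f"
    using var_wrt_eq_inner[OF f] by (simp add: autocov_def)
  ultimately show "\<exists>N. \<forall>M\<ge>N. ereal (var_wrt \<mu> f) \<le> ereal (partial_variance M)"
    using partial_variance_ge by (intro exI[of _ 1]) auto
qed

end

text \<open>Letting \<open>l\<close> tend to 1 in the comparison of resolvents. The parameter attached to \<open>K1\<close> is
  \<open>\<phi> l = l / (l + c (1 - l))\<close>, the solution of \<open>1 / \<phi> l - 1 = c (1 / l - 1)\<close>, which also tends to 1.\<close>

lemma asym_var_compare:
  assumes R1: "reversible_kernel \<mu> K1" and R2: "reversible_kernel \<mu> K2" and f: "f \<in> L2 \<mu>"
    and le: "\<And>g. g \<in> L2 \<mu> \<Longrightarrow> dirichlet \<mu> K1 g \<le> c * dirichlet \<mu> K2 g"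
    and c: "0 < c"
  shows "asym_var \<mu> K2 f + ereal (var_wrt \<mu> f) \<le> ereal c * (asym_var \<mu> K1 f + ereal (var_wrt \<mu> f))"
proof -
  interpret R1: reversible_kernel \<mu> K1 by (rule R1)
  interpret R2: reversible_kernel \<mu> K2 by (rule R2)
  define f0 where "f0 = (\<lambda>x. f x - (\<integral>x. f x \<partial>\<mu>))"
  have f0: "f0 \<in> L2 \<mu>" unfolding f0_def by (rule R1.centred_L2[OF f])
  define v where "v = var_wrt \<mu> f"
  define \<phi> where "\<phi> l = l / (l + c * (1 - l))" for l :: real
  have near: "eventually (\<lambda>l::real. 0 < l \<and> l < 1) (at_left 1)"
    unfolding eventually_at_left_field by (intro exI[of _ 0]) auto
  have \<phi>: "0 < \<phi> l" "\<phi> l < 1" "1 / \<phi> l - 1 = c * (1 / l - 1)" if "0 < l \<and> l < 1" for l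
  proof -
    have p: "0 < l" "0 < c * (1 - l)" using that c by simp_all
    then show "0 < \<phi> l" "\<phi> l < 1" by (simp_all add: \<phi>_def)
    show "1 / \<phi> l - 1 = c * (1 / l - 1)" using p by (simp add: \<phi>_def field_simps)
  qed
  have \<phi>_lim: "(\<phi> \<longlongrightarrow> 1) (at_left 1)"
  proof -
    have "(\<phi> \<longlongrightarrow> 1 / (1 + c * (1 - 1))) (at_left 1)"
      unfolding \<phi>_def by (intro tendsto_intros) auto
    then show ?thesis by simp
  qed
  have \<phi>_filter: "filterlim \<phi> (at_left 1) (at_left 1)"
    using \<phi>_lim near by (rule tendsto_imp_filterlim_at_left[OF _ eventually_mono]) (use \<phi> in auto)
  have lim1: "((\<lambda>l. ereal (R1.abel_autocov (\<phi> l) f0)) \<longlongrightarrow> (asym_var \<mu> K1 f + ereal v) / 2) (at_left 1)"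
    using filterlim_compose[OF R1.asym_var_abel(2)[OF f] \<phi>_filter] by (simp add: f0_def v_def)
  have lim2: "((\<lambda>l. ereal (R2.abel_autocov l f0)) \<longlongrightarrow> (asym_var \<mu> K2 f + ereal v) / 2) (at_left 1)"
    using R2.asym_var_abel(2)[OF f] by (simp add: f0_def v_def)
  have cmp: "eventually (\<lambda>l. R2.abel_autocov l f0 \<le> c * \<phi> l / l * R1.abel_autocov (\<phi> l) f0) (at_left 1)"
    using near
  proof eventually_elim
    case (elim l)
    show ?case by (rule abel_autocov_compare[OF R1 R2 f0 le c]) (use \<phi> elim in auto)
  qed
  have "asym_var \<mu> K2 f + ereal v \<le> ereal c * (asym_var \<mu> K1 f + ereal v)"
  proof (cases "asym_var \<mu> K1 f")
    case (real r)
    have "((\<lambda>l. R1.abel_autocov (\<phi> l) f0) \<longlongrightarrow> (r + v) / 2) (at_left 1)"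
      using lim1 real by simp
    then have "((\<lambda>l. c * \<phi> l / l * R1.abel_autocov (\<phi> l) f0) \<longlongrightarrow> c * 1 / 1 * ((r + v) / 2)) (at_left 1)"
      using \<phi>_lim by (intro tendsto_intros) auto
    then have "((\<lambda>l. ereal (c * \<phi> l / l * R1.abel_autocov (\<phi> l) f0)) \<longlongrightarrow> ereal (c * ((r + v) / 2))) (at_left 1)"
      by simp
    from tendsto_le[OF _ this lim2] cmp
    have "(asym_var \<mu> K2 f + ereal v) / 2 \<le> ereal (c * ((r + v) / 2))" by simp
    then show ?thesis using real by (cases "asym_var \<mu> K2 f") auto
  next
    case PInf then show ?thesis using c by simp
  next
    case MInf then show ?thesis using R1.asym_var_nonneg[OF f] by simp
  qed
  then show ?thesis by (simp add: v_def)
qed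

section \<open>Dirichlet forms against variances\<close>

text \<open>Independent sampling; on a fibre this is the kernel that generates the Gibbs sampler.\<close>

lemma reversible_kernel_const:
  assumes "prob_space \<mu>" shows "reversible_kernel \<mu> (\<lambda>_. \<mu>)"
proof -
  interpret prob_space \<mu> by fact
  show ?thesis
  proof
    show "(\<lambda>_. \<mu>) \<in> \<mu> \<rightarrow>\<^sub>M prob_algebra \<mu>"
      by (intro measurable_const) (simp add: space_prob_algebra prob_space_axioms)
    show "reversible \<mu> (\<lambda>_. \<mu>)"
      unfolding reversible_def by (simp add: nn_integral_cmult_indicator) (simp add: mult.commute)
  qed
qed

context reversible_kernel
begin

text \<open>In the extended nonnegative form the Dirichlet form can be averaged over fibres without integrability
  side conditions.\<close>

lemma nn_integral_difference_squares:
  assumes f: "f \<in> L2 \<mu>"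
  shows "(\<integral>\<^sup>+x. \<integral>\<^sup>+y. ennreal ((f x - f y)\<^sup>2 / 2) \<partial>K x \<partial>\<mu>) = ennreal (dirichlet \<mu> K f)"
    and "(\<integral>\<^sup>+x. \<integral>\<^sup>+y. ennreal ((f x + f y)\<^sup>2) \<partial>K x \<partial>\<mu>)
      = ennreal (2 * (L2_inner \<mu> f f + L2_inner \<mu> f (kernel_op K f)))"
proof -
  note [measurable] = L2D(1)[OF f]
  have I: "integrable J (\<lambda>z. (f (fst z) - f (snd z))\<^sup>2 / 2)" "integrable J (\<lambda>z. (f (fst z) + f (snd z))\<^sup>2)"
    using integrable_J_fst[OF L2D(2)[OF f]] integrable_J_snd[OF L2D(2)[OF f]] integrable_J_mult[OF f f]
    by (auto simp: power2_diff power2_sum mult.assoc)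
  have "(\<integral>\<^sup>+x. \<integral>\<^sup>+y. ennreal ((f x - f y)\<^sup>2 / 2) \<partial>K x \<partial>\<mu>) = (\<integral>\<^sup>+z. ennreal ((f (fst z) - f (snd z))\<^sup>2 / 2) \<partial>J)"
    by (subst nn_integral_joint_law[OF prob_space_axioms kernel]) auto
  then show "(\<integral>\<^sup>+x. \<integral>\<^sup>+y. ennreal ((f x - f y)\<^sup>2 / 2) \<partial>K x \<partial>\<mu>) = ennreal (dirichlet \<mu> K f)"
    using nn_integral_eq_integral[OF I(1)] sum_square_J(2)[OF f] dirichlet_eq[OF f]
    by (simp add: diff_divide_distrib)
  have "(\<integral>\<^sup>+x. \<integral>\<^sup>+y. ennreal ((f x + f y)\<^sup>2) \<partial>K x \<partial>\<mu>) = (\<integral>\<^sup>+z. ennreal ((f (fst z) + f (snd z))\<^sup>2) \<partial>J)"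
    by (subst nn_integral_joint_law[OF prob_space_axioms kernel]) auto
  then show "(\<integral>\<^sup>+x. \<integral>\<^sup>+y. ennreal ((f x + f y)\<^sup>2) \<partial>K x \<partial>\<mu>)
      = ennreal (2 * (L2_inner \<mu> f f + L2_inner \<mu> f (kernel_op K f)))"
    using nn_integral_eq_integral[OF I(2)] sum_square_J(1)[OF f] by simp
qed

lemma dirichlet_centred:
  assumes f: "f \<in> L2 \<mu>"
  defines "f0 \<equiv> \<lambda>x. f x - (\<integral>x. f x \<partial>\<mu>)"
  shows "dirichlet \<mu> K f = var_wrt \<mu> f - L2_inner \<mu> f0 (kernel_op K f0)"
  unfolding dirichlet_minus_const[OF f, of "\<integral>x. f x \<partial>\<mu>", symmetric] var_wrt_eq_inner[OF f] f0_def
  by (rule dirichlet_eq[OF centred_L2[OF f]])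

lemma dirichlet_le_two_var: "f \<in> L2 \<mu> \<Longrightarrow> dirichlet \<mu> K f \<le> 2 * var_wrt \<mu> f"
  using inner_kernel_bound[OF centred_L2, of f] by (simp add: dirichlet_centred var_wrt_eq_inner abs_le_iff)

lemma dirichlet_le_var_positive:
  "positive_kernel \<mu> K \<Longrightarrow> f \<in> L2 \<mu> \<Longrightarrow> dirichlet \<mu> K f \<le> var_wrt \<mu> f"
  using centred_L2[of f] by (simp add: dirichlet_centred positive_kernel_def)

text \<open>For centred \<open>f\<close>, the mean of \<open>(f x + f y)\<^sup>2\<close> is \<open>2 (\<parallel>f\<parallel>\<^sup>2 + \<langle>f, K f\<rangle>)\<close> under \<open>K\<close> and \<open>2 \<parallel>f\<parallel>\<^sup>2\<close> under independent
  sampling. The minorisation bounds the first below by \<open>\<epsilon>\<close> times the second, that is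
  \<open>\<langle>f, K f\<rangle> \<ge> - (1 - \<epsilon>) \<parallel>f\<parallel>\<^sup>2\<close>.\<close>

lemma dirichlet_le_var_minorised:
  assumes eps: "0 < \<epsilon>" and minor: "\<And>x B. x \<in> space \<mu> \<Longrightarrow> B \<in> sets \<mu> \<Longrightarrow> \<epsilon> * measure \<mu> B \<le> measure (K x) B"
    and f: "f \<in> L2 \<mu>"
  shows "dirichlet \<mu> K f \<le> (2 - \<epsilon>) * var_wrt \<mu> f"
proof -
  interpret C: reversible_kernel \<mu> "\<lambda>_. \<mu>" by (rule reversible_kernel_const) unfold_locales
  define f0 where "f0 = (\<lambda>x. f x - (\<integral>x. f x \<partial>\<mu>))"
  have f0: "f0 \<in> L2 \<mu>" and m0: "(\<integral>x. f0 x \<partial>\<mu>) = 0"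
    using centred_L2_zero[OF f] by (auto simp: f0_def L2_zero_def)
  note [measurable] = L2D(1)[OF f0]
  have "L2_inner \<mu> f0 (kernel_op (\<lambda>_. \<mu>) f0) = 0"
    by (simp add: kernel_op_def[abs_def] m0 L2_inner_def)
  then have "ennreal (\<epsilon> * (2 * L2_inner \<mu> f0 f0)) = ennreal \<epsilon> * (\<integral>\<^sup>+x. \<integral>\<^sup>+y. ennreal ((f0 x + f0 y)\<^sup>2) \<partial>\<mu> \<partial>\<mu>)"
    using eps by (simp add: C.nn_integral_difference_squares(2)[OF f0] ennreal_mult L2_inner_self_nonneg)
  also have "\<dots> = (\<integral>\<^sup>+x. \<integral>\<^sup>+y. ennreal ((f0 x + f0 y)\<^sup>2) \<partial>scale_measure (ennreal \<epsilon>) \<mu> \<partial>\<mu>)"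
    by (simp add: nn_integral_scale_measure nn_integral_cmult)
  also have "\<dots> \<le> (\<integral>\<^sup>+x. \<integral>\<^sup>+y. ennreal ((f0 x + f0 y)\<^sup>2) \<partial>K x \<partial>\<mu>)"
  proof (rule nn_integral_mono)
    fix x assume x: "x \<in> space \<mu>"
    interpret Kx: prob_space "K x" by (rule Kprob[OF x])
    have "scale_measure (ennreal \<epsilon>) \<mu> \<le> K x"
    proof (rule le_measure[THEN iffD2])
      show "sets (scale_measure (ennreal \<epsilon>) \<mu>) = sets (K x)" by (simp add: Ksets[OF x])
      show "\<forall>B\<in>sets (scale_measure (ennreal \<epsilon>) \<mu>). emeasure (scale_measure (ennreal \<epsilon>) \<mu>) B \<le> emeasure (K x) B"
        using minor[OF x] eps by (auto simp: emeasure_eq_measure Kx.emeasure_eq_measure ennreal_mult[symmetric])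
    qed
    then show "(\<integral>\<^sup>+y. ennreal ((f0 x + f0 y)\<^sup>2) \<partial>scale_measure (ennreal \<epsilon>) \<mu>) \<le> (\<integral>\<^sup>+y. ennreal ((f0 x + f0 y)\<^sup>2) \<partial>K x)"
      by (intro nn_integral_mono_measure) (auto simp: Ksets[OF x])
  qed
  also have "\<dots> = ennreal (2 * (L2_inner \<mu> f0 f0 + L2_inner \<mu> f0 (kernel_op K f0)))"
    by (rule nn_integral_difference_squares(2)[OF f0])
  finally have "\<epsilon> * (2 * L2_inner \<mu> f0 f0) \<le> 2 * (L2_inner \<mu> f0 f0 + L2_inner \<mu> f0 (kernel_op K f0))"
    using inner_kernel_bound[OF f0] by (subst (asm) ennreal_le_iff) (auto simp: abs_le_iff)
  then show ?thesis
    using dirichlet_centred[OF f] var_wrt_eq_inner[OF f] by (simp add: f0_def algebra_simps)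
qed

text \<open>The centred function competes in the infimum defining the gap, unless its variance vanishes; in that case
  the left side is 0 even if the gap is infinite.\<close>

lemma Gap_times_var_le:
  assumes f: "f \<in> L2 \<mu>"
  shows "ennreal (var_wrt \<mu> f) * e2ennreal (Gap \<mu> K) \<le> ennreal (dirichlet \<mu> K f)"
proof (cases "var_wrt \<mu> f = 0")
  case False
  define f0 where "f0 = (\<lambda>x. f x - (\<integral>x. f x \<partial>\<mu>))"
  have v: "L2_inner \<mu> f0 f0 = var_wrt \<mu> f" by (simp add: f0_def var_wrt_eq_inner[OF f])
  have v0: "0 < var_wrt \<mu> f" using False var_wrt_nonneg[OF f] by simp
  have "Gap \<mu> K \<le> ereal (dirichlet \<mu> K f0 / L2_inner \<mu> f0 f0)"
    unfolding Gap_def using False v centred_L2_zero[OF f] by (intro INF_lower) (simp add: f0_def)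
  also have "\<dots> = ereal (dirichlet \<mu> K f / var_wrt \<mu> f)"
    unfolding v unfolding f0_def dirichlet_minus_const[OF f] ..
  finally have "e2ennreal (Gap \<mu> K) \<le> ennreal (dirichlet \<mu> K f / var_wrt \<mu> f)"
    using e2ennreal_mono by (metis ennreal.abs_eq e2ennreal_ereal)
  then have "ennreal (var_wrt \<mu> f) * e2ennreal (Gap \<mu> K) \<le> ennreal (var_wrt \<mu> f) * ennreal (dirichlet \<mu> K f / var_wrt \<mu> f)"
    by (rule mult_left_mono) simp
  also have "\<dots> = ennreal (dirichlet \<mu> K f)"
    using v0 dirichlet_nonneg[OF f] by (simp add: ennreal_mult[symmetric])
  finally show ?thesis .
qed simp

end

lemma dirichlet_const_kernel:
  assumes "prob_space \<mu>" "f \<in> L2 \<mu>"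
  shows "dirichlet \<mu> (\<lambda>_. \<mu>) f = var_wrt \<mu> f"
proof -
  interpret reversible_kernel \<mu> "\<lambda>_. \<mu>" by (rule reversible_kernel_const[OF assms(1)])
  show ?thesis using dirichlet_eq[OF assms(2)]
    by (simp add: kernel_op_def[abs_def] L2_inner_const_right var_wrt_def L2_inner_def power2_eq_square)
qed

section \<open>Gibbs and Metropolis-within-Gibbs kernels\<close>

lemma prob_algebra_cong_sets: "sets M = sets N \<Longrightarrow> prob_algebra M = prob_algebra N"
  by (simp only: prob_algebra_def subprob_algebra_cong[of M N])

locale gibbs_setting =
  fixes \<pi> :: "('t \<times> 'x) measure" and T :: "'t measure" and X :: "'x measure"
    and \<pi>T :: "'t \<Rightarrow> 'x measure" and \<pi>X :: "'x \<Rightarrow> 't measure"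
  assumes prob_pi: "prob_space \<pi>" and sets_pi [measurable_cong]: "sets \<pi> = sets (T \<Otimes>\<^sub>M X)"
    and cond_snd: "is_cond_snd T X \<pi> \<pi>T" and cond_fst: "is_cond_fst T X \<pi> \<pi>X"
begin

definition "\<nu>T = distr \<pi> T fst"
definition "\<nu>X = distr \<pi> X snd"

lemma sets_nuT [measurable_cong, simp]: "sets \<nu>T = sets T" and space_nuT [simp]: "space \<nu>T = space T"
  and sets_nuX [measurable_cong, simp]: "sets \<nu>X = sets X" and space_nuX [simp]: "space \<nu>X = space X"
  by (simp_all add: \<nu>T_def \<nu>X_def)

lemma prob_nuT: "prob_space \<nu>T" and prob_nuX: "prob_space \<nu>X"
proof -
  have "fst \<in> \<pi> \<rightarrow>\<^sub>M T" "snd \<in> \<pi> \<rightarrow>\<^sub>M X"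
    using measurable_fst measurable_snd by (simp_all add: measurable_cong_sets[OF sets_pi refl])
  then show "prob_space \<nu>T" "prob_space \<nu>X"
    unfolding \<nu>T_def \<nu>X_def by (auto intro: prob_space.prob_space_distr[OF prob_pi])
qed

lemma piT [measurable]: "\<pi>T \<in> T \<rightarrow>\<^sub>M prob_algebra X" and piX [measurable]: "\<pi>X \<in> X \<rightarrow>\<^sub>M prob_algebra T"
  using cond_snd cond_fst by (auto simp: is_cond_snd_def is_cond_fst_def)

lemma piT_kernel: "\<pi>T \<in> \<nu>T \<rightarrow>\<^sub>M prob_algebra X" and piX_kernel: "\<pi>X \<in> \<nu>X \<rightarrow>\<^sub>M prob_algebra T"
  using piT piX by (simp_all add: measurable_cong_sets[OF sets_nuT refl] measurable_cong_sets[OF sets_nuX refl])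

lemma sets_piT: "\<theta> \<in> space T \<Longrightarrow> sets (\<pi>T \<theta>) = sets X" and prob_piT: "\<theta> \<in> space T \<Longrightarrow> prob_space (\<pi>T \<theta>)"
  using measurable_space[OF piT] by (auto simp: space_prob_algebra)

lemma sets_piX: "x \<in> space X \<Longrightarrow> sets (\<pi>X x) = sets T" and prob_piX: "x \<in> space X \<Longrightarrow> prob_space (\<pi>X x)"
  using measurable_space[OF piX] by (auto simp: space_prob_algebra)

lemma pi_eq_snd: "\<pi> = joint_law \<nu>T X \<pi>T"
proof (rule joint_law_eqI[OF prob_nuT piT_kernel])
  show "sets \<pi> = sets (\<nu>T \<Otimes>\<^sub>M X)"
    unfolding sets_pi by (rule sets_pair_measure_cong) simp_all
  show "emeasure \<pi> (A \<times> B) = (\<integral>\<^sup>+\<theta>\<in>A. emeasure (\<pi>T \<theta>) B \<partial>\<nu>T)" if "A \<in> sets \<nu>T" "B \<in> sets X" for A B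
    using cond_snd that by (simp add: is_cond_snd_def \<nu>T_def)
qed

lemma pi_eq_fst: "distr \<pi> (\<nu>X \<Otimes>\<^sub>M T) (\<lambda>z. (snd z, fst z)) = joint_law \<nu>X T \<pi>X"
proof (rule joint_law_eqI[OF prob_nuX piX_kernel])
  fix B A assume B: "B \<in> sets \<nu>X" and A: "A \<in> sets T"
  have "(\<lambda>z. (snd z, fst z)) -` (B \<times> A) \<inter> space \<pi> = A \<times> B"
    using A B[unfolded sets_nuX] sets_eq_imp_space_eq[OF sets_pi]
    by (auto simp: space_pair_measure dest: sets.sets_into_space)
  then have "emeasure (distr \<pi> (\<nu>X \<Otimes>\<^sub>M T) (\<lambda>z. (snd z, fst z))) (B \<times> A) = emeasure \<pi> (A \<times> B)"
    using A B by (subst emeasure_distr) auto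
  then show "emeasure (distr \<pi> (\<nu>X \<Otimes>\<^sub>M T) (\<lambda>z. (snd z, fst z))) (B \<times> A) = (\<integral>\<^sup>+x\<in>B. emeasure (\<pi>X x) A \<partial>\<nu>X)"
    using cond_fst A B by (simp add: is_cond_fst_def \<nu>X_def)
qed simp

text \<open>Both iterated integrals are integrals over the joint law \<open>\<pi>\<close>.\<close>

lemma nn_integral_disintegrate:
  assumes G [measurable]: "G \<in> borel_measurable (T \<Otimes>\<^sub>M X)"
  shows "(\<integral>\<^sup>+x. \<integral>\<^sup>+\<theta>. G (\<theta>, x) \<partial>\<pi>X x \<partial>\<nu>X) = (\<integral>\<^sup>+\<theta>. \<integral>\<^sup>+x. G (\<theta>, x) \<partial>\<pi>T \<theta> \<partial>\<nu>T)"
proof -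
  have "(\<integral>\<^sup>+x. \<integral>\<^sup>+\<theta>. G (\<theta>, x) \<partial>\<pi>X x \<partial>\<nu>X) = (\<integral>\<^sup>+z. G (snd z, fst z) \<partial>joint_law \<nu>X T \<pi>X)"
    by (subst nn_integral_joint_law[OF prob_nuX piX_kernel]) auto
  also have "\<dots> = (\<integral>\<^sup>+z. G z \<partial>\<pi>)"
    unfolding pi_eq_fst[symmetric] by (subst nn_integral_distr) auto
  also have "\<dots> = (\<integral>\<^sup>+z. G z \<partial>joint_law \<nu>T X \<pi>T)"
    using pi_eq_snd by simp
  also have "\<dots> = (\<integral>\<^sup>+\<theta>. \<integral>\<^sup>+x. G (\<theta>, x) \<partial>\<pi>T \<theta> \<partial>\<nu>T)"
    by (subst nn_integral_joint_law[OF prob_nuT piT_kernel]) auto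
  finally show ?thesis .
qed

lemma AE_fibre_L2:
  assumes f: "f \<in> L2 \<nu>X" shows "AE \<theta> in \<nu>T. f \<in> L2 (\<pi>T \<theta>)"
proof -
  have [measurable]: "f \<in> borel_measurable X" using L2D(1)[OF f] by (simp cong: measurable_cong_sets)
  have "integrable \<pi> (\<lambda>z. (f (snd z))\<^sup>2)"
    using L2D(2)[OF f] unfolding \<nu>X_def by (subst (asm) integrable_distr_eq) auto
  then have "integrable (joint_law \<nu>T X \<pi>T) (\<lambda>z. (f (snd z))\<^sup>2)"
    using pi_eq_snd by simp
  from integral_joint_law(1)[OF prob_nuT piT_kernel this] AE_space
  show ?thesis
    by eventually_elim (auto simp: L2_def sets_piT cong: measurable_cong_sets)
qed

lemma norm_fibre:
  assumes f: "f \<in> L2 \<nu>X"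
  shows "ennreal (L2_inner \<nu>X f f) = (\<integral>\<^sup>+\<theta>. ennreal (L2_inner (\<pi>T \<theta>) f f) \<partial>\<nu>T)"
proof -
  have [measurable]: "f \<in> borel_measurable X" using L2D(1)[OF f] by (simp cong: measurable_cong_sets)
  have "ennreal (L2_inner \<nu>X f f) = (\<integral>\<^sup>+x. ennreal ((f x)\<^sup>2) \<partial>\<nu>X)"
    using nn_integral_eq_integral[OF L2D(2)[OF f]] by (simp add: L2_inner_def power2_eq_square)
  also have "\<dots> = (\<integral>\<^sup>+x. \<integral>\<^sup>+\<theta>. ennreal ((f x)\<^sup>2) \<partial>\<pi>X x \<partial>\<nu>X)"
    by (intro nn_integral_cong) (simp add: prob_space.emeasure_space_1[OF prob_piX])
  also have "\<dots> = (\<integral>\<^sup>+\<theta>. \<integral>\<^sup>+x. ennreal ((f x)\<^sup>2) \<partial>\<pi>T \<theta> \<partial>\<nu>T)"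
    using nn_integral_disintegrate[of "\<lambda>z. ennreal ((f (snd z))\<^sup>2)"] by simp
  also have "\<dots> = (\<integral>\<^sup>+\<theta>. ennreal (L2_inner (\<pi>T \<theta>) f f) \<partial>\<nu>T)"
  proof (rule nn_integral_cong_AE)
    show "AE \<theta> in \<nu>T. (\<integral>\<^sup>+x. ennreal ((f x)\<^sup>2) \<partial>\<pi>T \<theta>) = ennreal (L2_inner (\<pi>T \<theta>) f f)"
      using AE_fibre_L2[OF f]
    proof eventually_elim
      case (elim \<theta>)
      have "(\<integral>\<^sup>+x. ennreal ((f x)\<^sup>2) \<partial>\<pi>T \<theta>) = ennreal (\<integral>x. (f x)\<^sup>2 \<partial>\<pi>T \<theta>)"
        by (rule nn_integral_eq_integral[OF L2D(2)[OF elim]]) simp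
      then show ?case by (simp add: L2_inner_def power2_eq_square)
    qed
  qed
  finally show ?thesis .
qed

end

locale fibre_kernels = gibbs_setting +
  fixes P :: "'a \<Rightarrow> 'b \<Rightarrow> 'b measure"
  assumes P_kernel [measurable]: "case_prod P \<in> (T \<Otimes>\<^sub>M X) \<rightarrow>\<^sub>M prob_algebra X"
    and P_reversible: "\<And>\<theta>. \<theta> \<in> space T \<Longrightarrow> reversible (\<pi>T \<theta>) (P \<theta>)"
begin

abbreviation "\<Phi> \<equiv> mwg_x \<pi>X P"

lemma fibre_reversible_kernel:
  assumes "\<theta> \<in> space T" shows "reversible_kernel (\<pi>T \<theta>) (P \<theta>)"
proof -
  have "P \<theta> \<in> X \<rightarrow>\<^sub>M prob_algebra X"
    using measurable_compose[OF measurable_Pair1'[OF assms] P_kernel] by simp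
  then have "P \<theta> \<in> \<pi>T \<theta> \<rightarrow>\<^sub>M prob_algebra (\<pi>T \<theta>)"
    using prob_algebra_cong_sets[OF sets_piT[OF assms]] by (simp add: sets_piT[OF assms] cong: measurable_cong_sets)
  with P_reversible[OF assms] prob_piT[OF assms] show ?thesis
    by (simp add: reversible_kernel_def reversible_kernel_axioms_def)
qed

lemma P_parameter_kernel:
  assumes "x \<in> space X" shows "(\<lambda>\<theta>. P \<theta> x) \<in> T \<rightarrow>\<^sub>M prob_algebra X"
  using measurable_compose[OF measurable_Pair2'[OF assms] P_kernel] by simp

lemma Phi_kernel: "\<Phi> \<in> \<nu>X \<rightarrow>\<^sub>M prob_algebra \<nu>X"
proof -
  have "(\<lambda>(x, \<theta>). P \<theta> x) \<in> (X \<Otimes>\<^sub>M T) \<rightarrow>\<^sub>M prob_algebra X"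
    using measurable_compose[OF measurable_pair_swap' P_kernel] by (simp add: case_prod_unfold)
  then have "\<Phi> \<in> X \<rightarrow>\<^sub>M prob_algebra X"
    unfolding mwg_x_def[abs_def] by (rule measurable_bind_prob_space2[OF piX])
  then show ?thesis
    using prob_algebra_cong_sets[OF sets_nuX] by (simp cong: measurable_cong_sets)
qed

lemma nn_integral_Phi:
  assumes F [measurable]: "F \<in> borel_measurable (X \<Otimes>\<^sub>M X)"
  shows "(\<integral>\<^sup>+x. \<integral>\<^sup>+y. F (x, y) \<partial>\<Phi> x \<partial>\<nu>X) = (\<integral>\<^sup>+\<theta>. \<integral>\<^sup>+x. \<integral>\<^sup>+y. F (x, y) \<partial>P \<theta> x \<partial>\<pi>T \<theta> \<partial>\<nu>T)"
proof -
  let ?G = "\<lambda>z. \<integral>\<^sup>+y. F (snd z, y) \<partial>P (fst z) (snd z)"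
  have G: "?G \<in> borel_measurable (T \<Otimes>\<^sub>M X)"
  proof (rule nn_integral_measurable_subprob_algebra2)
    show "(\<lambda>z. P (fst z) (snd z)) \<in> T \<Otimes>\<^sub>M X \<rightarrow>\<^sub>M subprob_algebra X"
      using measurable_prob_algebraD[OF P_kernel] by (simp add: case_prod_unfold)
    have "(\<lambda>w. (snd (fst w), snd w)) \<in> (T \<Otimes>\<^sub>M X) \<Otimes>\<^sub>M X \<rightarrow>\<^sub>M X \<Otimes>\<^sub>M X"
      by measurable
    from measurable_compose[OF this F]
    show "(\<lambda>(z, y). F (snd z, y)) \<in> borel_measurable ((T \<Otimes>\<^sub>M X) \<Otimes>\<^sub>M X)"
      by (simp add: case_prod_unfold)
  qed
  have "(\<integral>\<^sup>+x. \<integral>\<^sup>+y. F (x, y) \<partial>\<Phi> x \<partial>\<nu>X) = (\<integral>\<^sup>+x. \<integral>\<^sup>+\<theta>. ?G (\<theta>, x) \<partial>\<pi>X x \<partial>\<nu>X)"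
  proof (rule nn_integral_cong)
    fix x assume "x \<in> space \<nu>X"
    then have x: "x \<in> space X" by simp
    then have "(\<lambda>y. F (x, y)) \<in> borel_measurable X"
      using measurable_compose[OF measurable_Pair1' F] by blast
    then show "(\<integral>\<^sup>+y. F (x, y) \<partial>\<Phi> x) = (\<integral>\<^sup>+\<theta>. ?G (\<theta>, x) \<partial>\<pi>X x)"
      unfolding mwg_x_def using nn_integral_bind_kernel[OF sets_piX[OF x] P_parameter_kernel[OF x]] by simp
  qed
  also have "\<dots> = (\<integral>\<^sup>+\<theta>. \<integral>\<^sup>+x. ?G (\<theta>, x) \<partial>\<pi>T \<theta> \<partial>\<nu>T)"
    by (rule nn_integral_disintegrate[OF G])
  finally show ?thesis by simp
qed

lemma Phi_reversible: "reversible \<nu>X \<Phi>"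
  unfolding reversible_def
proof (intro ballI)
  fix A B assume "A \<in> sets \<nu>X" "B \<in> sets \<nu>X"
  then have AB [measurable]: "A \<in> sets X" "B \<in> sets X" by simp_all
  have key: "(\<integral>\<^sup>+x\<in>C. emeasure (\<Phi> x) D \<partial>\<nu>X) = (\<integral>\<^sup>+\<theta>. (\<integral>\<^sup>+x\<in>C. emeasure (P \<theta> x) D \<partial>\<pi>T \<theta>) \<partial>\<nu>T)"
    if CD [measurable]: "C \<in> sets X" "D \<in> sets X" for C D
  proof -
    have ind: "(\<integral>\<^sup>+y. indicator C x * indicator D y \<partial>\<kappa>) = emeasure \<kappa> D * indicator C x"
      if "sets \<kappa> = sets X" for \<kappa> :: "'b measure" and x
      using that CD by (simp add: nn_integral_cmult_indicator mult.commute)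
    have sP: "sets (P \<theta> x) = sets X" if "\<theta> \<in> space T" "x \<in> space X" for \<theta> x
      using measurable_space[OF P_kernel, of "(\<theta>, x)"] that by (auto simp: space_prob_algebra space_pair_measure)
    have sPhi: "sets (\<Phi> x) = sets X" if "x \<in> space X" for x
      using measurable_space[OF Phi_kernel, of x] that by (auto simp: space_prob_algebra)
    have sp: "space (\<pi>T \<theta>) = space X" if "\<theta> \<in> space T" for \<theta>
      using sets_eq_imp_space_eq[OF sets_piT[OF that]] .
    have "(\<integral>\<^sup>+x\<in>C. emeasure (\<Phi> x) D \<partial>\<nu>X) = (\<integral>\<^sup>+x. \<integral>\<^sup>+y. indicator C x * indicator D y \<partial>\<Phi> x \<partial>\<nu>X)"
      by (intro nn_integral_cong, subst ind) (auto simp: sPhi)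
    also have "\<dots> = (\<integral>\<^sup>+\<theta>. \<integral>\<^sup>+x. \<integral>\<^sup>+y. indicator C x * indicator D y \<partial>P \<theta> x \<partial>\<pi>T \<theta> \<partial>\<nu>T)"
      using nn_integral_Phi[of "\<lambda>z. indicator C (fst z) * indicator D (snd z)"] by simp
    also have "\<dots> = (\<integral>\<^sup>+\<theta>. (\<integral>\<^sup>+x\<in>C. emeasure (P \<theta> x) D \<partial>\<pi>T \<theta>) \<partial>\<nu>T)"
      by (intro nn_integral_cong, subst ind) (auto simp: sP sp)
    finally show ?thesis .
  qed
  show "(\<integral>\<^sup>+x\<in>A. emeasure (\<Phi> x) B \<partial>\<nu>X) = (\<integral>\<^sup>+x\<in>B. emeasure (\<Phi> x) A \<partial>\<nu>X)"
    unfolding key[OF AB] key[OF AB(2,1)]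
  proof (rule nn_integral_cong)
    fix \<theta> assume "\<theta> \<in> space \<nu>T"
    then show "(\<integral>\<^sup>+x\<in>A. emeasure (P \<theta> x) B \<partial>\<pi>T \<theta>) = (\<integral>\<^sup>+x\<in>B. emeasure (P \<theta> x) A \<partial>\<pi>T \<theta>)"
      using P_reversible[of \<theta>] AB by (simp add: reversible_def sets_piT)
  qed
qed

sublocale Phi: reversible_kernel \<nu>X \<Phi>
  using prob_nuX Phi_kernel Phi_reversible
  by (simp add: reversible_kernel_def reversible_kernel_axioms_def)

text \<open>The mean of \<open>(f x - f y)\<^sup>2 / 2\<close> over a step of the sampler, with the order of drawing \<open>x\<close> and \<open>\<theta>\<close> exchanged.\<close>

lemma dirichlet_fibre:
  assumes f: "f \<in> L2 \<nu>X"
  shows "ennreal (dirichlet \<nu>X \<Phi> f) = (\<integral>\<^sup>+\<theta>. ennreal (dirichlet (\<pi>T \<theta>) (P \<theta>) f) \<partial>\<nu>T)"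
proof -
  have [measurable]: "f \<in> borel_measurable X" using L2D(1)[OF f] by (simp cong: measurable_cong_sets)
  have "ennreal (dirichlet \<nu>X \<Phi> f) = (\<integral>\<^sup>+x. \<integral>\<^sup>+y. ennreal ((f x - f y)\<^sup>2 / 2) \<partial>\<Phi> x \<partial>\<nu>X)"
    by (rule Phi.nn_integral_difference_squares(1)[OF f, symmetric])
  also have "\<dots> = (\<integral>\<^sup>+\<theta>. \<integral>\<^sup>+x. \<integral>\<^sup>+y. ennreal ((f x - f y)\<^sup>2 / 2) \<partial>P \<theta> x \<partial>\<pi>T \<theta> \<partial>\<nu>T)"
    using nn_integral_Phi[of "\<lambda>z. ennreal ((f (fst z) - f (snd z))\<^sup>2 / 2)"] by simp
  also have "\<dots> = (\<integral>\<^sup>+\<theta>. ennreal (dirichlet (\<pi>T \<theta>) (P \<theta>) f) \<partial>\<nu>T)"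
  proof (rule nn_integral_cong_AE)
    show "AE \<theta> in \<nu>T. (\<integral>\<^sup>+x. \<integral>\<^sup>+y. ennreal ((f x - f y)\<^sup>2 / 2) \<partial>P \<theta> x \<partial>\<pi>T \<theta>)
        = ennreal (dirichlet (\<pi>T \<theta>) (P \<theta>) f)"
      using AE_fibre_L2[OF f] AE_space
      by eventually_elim (simp add: reversible_kernel.nn_integral_difference_squares(1)[OF fibre_reversible_kernel])
  qed
  finally show ?thesis .
qed

end

context gibbs_setting
begin

abbreviation "\<Gamma> \<equiv> gibbs_x \<pi>X \<pi>T"

lemma gibbs_eq_mwg: "\<Gamma> = mwg_x \<pi>X (\<lambda>\<theta> _. \<pi>T \<theta>)"
  by (simp add: gibbs_x_def mwg_x_def fun_eq_iff)

lemma fibre_kernels_gibbs: "fibre_kernels \<pi> T X \<pi>T \<pi>X (\<lambda>\<theta> _. \<pi>T \<theta>)"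
proof
  show "(\<lambda>(\<theta>, _). \<pi>T \<theta>) \<in> T \<Otimes>\<^sub>M X \<rightarrow>\<^sub>M prob_algebra X"
    by measurable
  show "reversible (\<pi>T \<theta>) (\<lambda>_. \<pi>T \<theta>)" if "\<theta> \<in> space T" for \<theta>
    using reversible_kernel_const[OF prob_piT[OF that]]
    by (simp add: reversible_kernel_def reversible_kernel_axioms_def)
qed

lemma reversible_kernel_gibbs: "reversible_kernel \<nu>X \<Gamma>"
proof -
  interpret G: fibre_kernels \<pi> T X \<pi>T \<pi>X "\<lambda>\<theta> _. \<pi>T \<theta>" by (rule fibre_kernels_gibbs)
  show ?thesis unfolding gibbs_eq_mwg by (rule G.Phi.reversible_kernel_axioms)
qed

lemma mean_cond_var_eq_dirichlet:
  assumes f: "f \<in> L2 \<nu>X"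
  shows "mean_cond_var \<nu>T \<pi>T f = ennreal (dirichlet \<nu>X \<Gamma> f)"
proof -
  interpret G: fibre_kernels \<pi> T X \<pi>T \<pi>X "\<lambda>\<theta> _. \<pi>T \<theta>" by (rule fibre_kernels_gibbs)
  show ?thesis
    unfolding gibbs_eq_mwg G.dirichlet_fibre[OF f] mean_cond_var_def
  proof (rule nn_integral_cong_AE)
    show "AE \<theta> in \<nu>T. ennreal (var_wrt (\<pi>T \<theta>) f) = ennreal (dirichlet (\<pi>T \<theta>) (\<lambda>_. \<pi>T \<theta>) f)"
      using AE_fibre_L2[OF f] AE_space
      by eventually_elim (simp add: dirichlet_const_kernel prob_piT)
  qed
qed

text \<open>The form of the Gibbs kernel is the mean conditional variance, hence at most the mean conditional second
  moment, which is \<open>\<parallel>f\<parallel>\<^sup>2\<close>.\<close>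

lemma positive_kernel_gibbs: "positive_kernel \<nu>X \<Gamma>"
  unfolding positive_kernel_def
proof
  interpret Gam: reversible_kernel \<nu>X \<Gamma> by (rule reversible_kernel_gibbs)
  fix f assume f: "f \<in> L2 \<nu>X"
  have "ennreal (dirichlet \<nu>X \<Gamma> f) \<le> ennreal (L2_inner \<nu>X f f)"
    unfolding mean_cond_var_eq_dirichlet[OF f, symmetric] norm_fibre[OF f] mean_cond_var_def
    by (intro nn_integral_mono ennreal_leI) (simp add: var_wrt_def L2_inner_def power2_eq_square)
  then have "dirichlet \<nu>X \<Gamma> f \<le> L2_inner \<nu>X f f"
    by (subst (asm) ennreal_le_iff) (rule L2_inner_self_nonneg)
  then show "0 \<le> L2_inner \<nu>X f (kernel_op \<Gamma> f)"
    by (simp add: Gam.dirichlet_eq[OF f])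
qed

lemma var_wrt_fibre_measurable:
  assumes f: "f \<in> borel_measurable X"
  shows "(\<lambda>\<theta>. var_wrt (\<pi>T \<theta>) f) \<in> borel_measurable \<nu>T"
proof -
  have I: "(\<lambda>\<theta>. \<integral>x. g x \<partial>\<pi>T \<theta>) \<in> borel_measurable \<nu>T" if "g \<in> borel_measurable X" for g :: "'x \<Rightarrow> real"
    using measurable_compose[OF measurable_prob_algebraD[OF piT_kernel] integral_measurable_subprob_algebra[OF that]] .
  show ?thesis
    unfolding var_wrt_def using f by (intro borel_measurable_diff borel_measurable_power I)
qed

end

context fibre_kernels
begin

lemma dirichlet_le_gibbs:
  assumes f: "f \<in> L2 \<nu>X" and c: "0 \<le> c"
    and fibre: "\<And>\<theta>. \<theta> \<in> space T \<Longrightarrow> f \<in> L2 (\<pi>T \<theta>) \<Longrightarrow> dirichlet (\<pi>T \<theta>) (P \<theta>) f \<le> c * var_wrt (\<pi>T \<theta>) f"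
  shows "dirichlet \<nu>X \<Phi> f \<le> c * dirichlet \<nu>X \<Gamma> f"
proof -
  interpret Gam: reversible_kernel \<nu>X \<Gamma> by (rule reversible_kernel_gibbs)
  have fX: "f \<in> borel_measurable X" using L2D(1)[OF f] by (simp cong: measurable_cong_sets)
  have "ennreal (dirichlet \<nu>X \<Phi> f) \<le> (\<integral>\<^sup>+\<theta>. ennreal c * ennreal (var_wrt (\<pi>T \<theta>) f) \<partial>\<nu>T)"
    unfolding dirichlet_fibre[OF f]
  proof (rule nn_integral_mono_AE)
    show "AE \<theta> in \<nu>T. ennreal (dirichlet (\<pi>T \<theta>) (P \<theta>) f) \<le> ennreal c * ennreal (var_wrt (\<pi>T \<theta>) f)"
      using AE_fibre_L2[OF f] AE_space
    proof eventually_elim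
      case (elim \<theta>)
      then show ?case
        using fibre[of \<theta>] c prob_space.var_wrt_nonneg[OF prob_piT] by (simp add: ennreal_mult[symmetric])
    qed
  qed
  also have "\<dots> = ennreal c * mean_cond_var \<nu>T \<pi>T f"
    unfolding mean_cond_var_def using var_wrt_fibre_measurable[OF fX] by (intro nn_integral_cmult measurable_compose[OF _ measurable_ennreal])
  also have "\<dots> = ennreal (c * dirichlet \<nu>X \<Gamma> f)"
    using c Gam.dirichlet_nonneg[OF f] by (simp add: mean_cond_var_eq_dirichlet[OF f] ennreal_mult)
  finally show ?thesis
    using c Gam.dirichlet_nonneg[OF f] by (subst (asm) ennreal_le_iff) auto
qed

lemma mean_cond_var_gap_le:
  assumes f: "f \<in> L2 \<nu>X"
  shows "mean_cond_var_gap \<nu>T \<pi>T P f \<le> ennreal (dirichlet \<nu>X \<Phi> f)"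
  unfolding dirichlet_fibre[OF f] mean_cond_var_gap_def
proof (rule nn_integral_mono_AE)
  show "AE \<theta> in \<nu>T. ennreal (var_wrt (\<pi>T \<theta>) f) * e2ennreal (Gap (\<pi>T \<theta>) (P \<theta>))
      \<le> ennreal (dirichlet (\<pi>T \<theta>) (P \<theta>) f)"
    using AE_fibre_L2[OF f] AE_space
    by eventually_elim (simp add: reversible_kernel.Gap_times_var_le[OF fibre_reversible_kernel])
qed

lemma rho_nonneg: "0 \<le> rho \<nu>T \<nu>X \<pi>T P"
  unfolding rho_def by (rule INF_greatest) simp

text \<open>The function \<open>f\<close> competes in the infimum defining \<open>rho\<close>. Its quotient has denominator \<open>\<E>\<^sub>\<Gamma>(f)\<close> and a numerator at
  most \<open>\<E>\<^sub>\<Phi>(f)\<close>. If \<open>\<E>\<^sub>\<Gamma>(f) = 0\<close>, the left side is 0 even for \<open>rho = \<infinity>\<close>.\<close>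

lemma rho_dirichlet_le:
  assumes f: "f \<in> L2 \<nu>X"
  shows "rho \<nu>T \<nu>X \<pi>T P * ereal (dirichlet \<nu>X \<Gamma> f) \<le> ereal (dirichlet \<nu>X \<Phi> f)"
proof (cases "dirichlet \<nu>X \<Gamma> f = 0")
  case True
  then show ?thesis using Phi.dirichlet_nonneg[OF f] by (simp flip: zero_ereal_def)
next
  case False
  interpret Gam: reversible_kernel \<nu>X \<Gamma> by (rule reversible_kernel_gibbs)
  define G E where "G = dirichlet \<nu>X \<Gamma> f" and "E = dirichlet \<nu>X \<Phi> f"
  have GE: "0 < G" "0 \<le> E"
    using False Gam.dirichlet_nonneg[OF f] Phi.dirichlet_nonneg[OF f] by (auto simp: G_def E_def)
  have m: "mean_cond_var \<nu>T \<pi>T f = ennreal G" by (simp add: G_def mean_cond_var_eq_dirichlet[OF f])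
  have "rho \<nu>T \<nu>X \<pi>T P \<le> enn2ereal (mean_cond_var_gap \<nu>T \<pi>T P f / mean_cond_var \<nu>T \<pi>T f)"
    unfolding rho_def using f m GE by (intro INF_lower) auto
  also have "\<dots> \<le> enn2ereal (ennreal E / ennreal G)"
    unfolding m using mean_cond_var_gap_le[OF f]
    by (simp add: less_eq_ennreal.rep_eq[symmetric] E_def divide_right_mono_ennreal)
  also have "\<dots> = ereal (E / G)"
    using GE by (simp add: divide_ennreal enn2ereal_ennreal)
  finally have "rho \<nu>T \<nu>X \<pi>T P * ereal G \<le> ereal (E / G) * ereal G"
    using GE by (intro ereal_mult_right_mono) auto
  then show ?thesis using GE by (simp add: G_def E_def)
qed

end

lemma Gap_mono_mult:
  assumes c: "0 < c" and le: "\<And>f. f \<in> L2 \<mu> \<Longrightarrow> dirichlet \<mu> K1 f \<le> c * dirichlet \<mu> K2 f"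
  shows "Gap \<mu> K1 \<le> ereal c * Gap \<mu> K2"
proof -
  have "Gap \<mu> K1 / ereal c \<le> Gap \<mu> K2"
    unfolding Gap_def[of _ K2]
  proof (rule INF_greatest)
    fix f assume f: "f \<in> {f \<in> L2_zero \<mu>. L2_inner \<mu> f f \<noteq> 0}"
    then have f2: "f \<in> L2 \<mu>" by (simp add: L2_zero_def)
    have "Gap \<mu> K1 \<le> ereal (dirichlet \<mu> K1 f / L2_inner \<mu> f f)"
      unfolding Gap_def by (rule INF_lower[OF f])
    also have "\<dots> \<le> ereal (c * dirichlet \<mu> K2 f / L2_inner \<mu> f f)"
      using le[OF f2] L2_inner_self_nonneg[of \<mu> f] by (simp add: divide_right_mono)
    finally show "Gap \<mu> K1 / ereal c \<le> ereal (dirichlet \<mu> K2 f / L2_inner \<mu> f f)"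
      using c by (subst ereal_divide_le_pos) auto
  qed
  then show ?thesis using c by (subst (asm) ereal_divide_le_pos) auto
qed

lemma Gap_ge_mult:
  assumes r: "0 \<le> r" and le: "\<And>f. f \<in> L2 \<mu> \<Longrightarrow> r * ereal (dirichlet \<mu> K2 f) \<le> ereal (dirichlet \<mu> K1 f)"
  shows "r * Gap \<mu> K2 \<le> Gap \<mu> K1"
  unfolding Gap_def[of _ K1]
proof (rule INF_greatest)
  fix f assume f: "f \<in> {f \<in> L2_zero \<mu>. L2_inner \<mu> f f \<noteq> 0}"
  then have f2: "f \<in> L2 \<mu>" by (simp add: L2_zero_def)
  define n where "n = L2_inner \<mu> f f"
  have n: "0 < n" using f L2_inner_self_nonneg[of \<mu> f] by (auto simp: n_def)
  have "r * Gap \<mu> K2 \<le> r * ereal (dirichlet \<mu> K2 f / n)"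
    unfolding Gap_def n_def by (intro ereal_mult_left_mono INF_lower f r)
  also have "\<dots> = r * ereal (dirichlet \<mu> K2 f) * ereal (1 / n)"
    by (simp add: mult.assoc)
  also have "\<dots> \<le> ereal (dirichlet \<mu> K1 f) * ereal (1 / n)"
    using le[OF f2] n by (intro ereal_mult_right_mono) auto
  also have "\<dots> = ereal (dirichlet \<mu> K1 f / n)" by simp
  finally show "r * Gap \<mu> K2 \<le> ereal (dirichlet \<mu> K1 f / L2_inner \<mu> f f)" by (simp add: n_def)
qed

section \<open>Comparison of Gibbs and Metropolis-within-Gibbs\<close>

theorem theorem25:
  fixes T :: "'t measure" and X :: "'x measure"
    and \<pi> :: "('t \<times> 'x) measure"
    and \<pi>T :: "'t \<Rightarrow> 'x measure" and \<pi>X :: "'x \<Rightarrow> 't measure"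
    and P :: "'t \<Rightarrow> 'x \<Rightarrow> 'x measure"
  defines "\<nu>T \<equiv> distr \<pi> T fst" and "\<nu>X \<equiv> distr \<pi> X snd"
    and "\<Gamma> \<equiv> gibbs_x \<pi>X \<pi>T" and "\<Phi> \<equiv> mwg_x \<pi>X P"
    and "\<rho> \<equiv> rho (distr \<pi> T fst) (distr \<pi> X snd) \<pi>T P"
  assumes "prob_space \<pi>" and "sets \<pi> = sets (T \<Otimes>\<^sub>M X)"
    and "is_cond_snd T X \<pi> \<pi>T" and "is_cond_fst T X \<pi> \<pi>X"
    and "case_prod P \<in> (T \<Otimes>\<^sub>M X) \<rightarrow>\<^sub>M prob_algebra X"
    and "\<And>\<theta>. \<theta> \<in> space T \<Longrightarrow> reversible (\<pi>T \<theta>) (P \<theta>)"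
  shows
    "(\<forall>f\<in>L2 \<nu>X.
        2 * dirichlet \<nu>X \<Gamma> f \<ge> dirichlet \<nu>X \<Phi> f \<and>
        ereal (dirichlet \<nu>X \<Phi> f) \<ge> \<rho> * ereal (dirichlet \<nu>X \<Gamma> f)) \<and>
     (2 * Gap \<nu>X \<Gamma> \<ge> Gap \<nu>X \<Phi> \<and> Gap \<nu>X \<Phi> \<ge> \<rho> * Gap \<nu>X \<Gamma>) \<and>
     (\<forall>f\<in>L2 \<nu>X.
        0 \<le> (asym_var \<nu>X \<Gamma> f - ereal (var_wrt \<nu>X f)) / 2 \<and>
        (asym_var \<nu>X \<Gamma> f - ereal (var_wrt \<nu>X f)) / 2 \<le> asym_var \<nu>X \<Phi> f \<and>
        (0 < \<rho> \<and> \<rho> < \<infinity> \<longrightarrow>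
          asym_var \<nu>X \<Phi> f \<le>
            (inverse \<rho> - 1) * ereal (var_wrt \<nu>X f) + inverse \<rho> * asym_var \<nu>X \<Gamma> f)) \<and>
     (\<forall>\<epsilon>::real. \<epsilon> > 0 \<and>
        (\<forall>\<theta>\<in>space T. \<forall>x\<in>space X. \<forall>B\<in>sets X.
           measure (P \<theta> x) B \<ge> \<epsilon> * measure (\<pi>T \<theta>) B) \<longrightarrow>
        (\<forall>f\<in>L2 \<nu>X.
           (asym_var \<nu>X \<Gamma> f - ereal ((1 - \<epsilon>) * var_wrt \<nu>X f)) / ereal (2 - \<epsilon>)
             \<le> asym_var \<nu>X \<Phi> f)) \<and>
     ((\<forall>\<theta>\<in>space T. positive_kernel (\<pi>T \<theta>) (P \<theta>)) \<longrightarrow>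
        (\<forall>f\<in>L2 \<nu>X. asym_var \<nu>X \<Gamma> f \<le> asym_var \<nu>X \<Phi> f))"
proof -
  interpret S: fibre_kernels \<pi> T X \<pi>T \<pi>X P
    using assms(6-11) by (simp add: fibre_kernels_def fibre_kernels_axioms_def gibbs_setting_def)
  have nu: "S.\<nu>T = \<nu>T" "S.\<nu>X = \<nu>X"
    by (simp_all add: S.\<nu>T_def S.\<nu>X_def \<nu>T_def \<nu>X_def)
  have rho: "rho \<nu>T \<nu>X \<pi>T P = \<rho>"
    by (simp add: \<rho>_def \<nu>T_def \<nu>X_def)
  have Gam: "reversible_kernel \<nu>X \<Gamma>"
    using S.reversible_kernel_gibbs by (simp add: nu \<Gamma>_def)
  have Phi: "reversible_kernel \<nu>X \<Phi>"
    using S.Phi.reversible_kernel_axioms by (simp add: nu \<Phi>_def)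
  interpret G: reversible_kernel \<nu>X \<Gamma> by (rule Gam)
  interpret F: reversible_kernel \<nu>X \<Phi> by (rule Phi)
  have le: "dirichlet \<nu>X \<Phi> f \<le> c * dirichlet \<nu>X \<Gamma> f"
    if "f \<in> L2 \<nu>X" "0 \<le> c"
      "\<And>\<theta>. \<theta> \<in> space T \<Longrightarrow> f \<in> L2 (\<pi>T \<theta>) \<Longrightarrow> dirichlet (\<pi>T \<theta>) (P \<theta>) f \<le> c * var_wrt (\<pi>T \<theta>) f" for f c
    using S.dirichlet_le_gibbs[of f c] that by (simp add: nu \<Gamma>_def \<Phi>_def)
  have le2: "dirichlet \<nu>X \<Phi> f \<le> 2 * dirichlet \<nu>X \<Gamma> f" if "f \<in> L2 \<nu>X" for f
    using that by (intro le reversible_kernel.dirichlet_le_two_var[OF S.fibre_reversible_kernel]) auto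
  have rho_le: "\<rho> * ereal (dirichlet \<nu>X \<Gamma> f) \<le> ereal (dirichlet \<nu>X \<Phi> f)" if "f \<in> L2 \<nu>X" for f
    using S.rho_dirichlet_le[of f] that by (simp add: nu rho \<Gamma>_def \<Phi>_def)
  have rho0: "0 \<le> \<rho>" using S.rho_nonneg by (simp add: nu rho)
  have a: "\<forall>f\<in>L2 \<nu>X. 2 * dirichlet \<nu>X \<Gamma> f \<ge> dirichlet \<nu>X \<Phi> f \<and>
      ereal (dirichlet \<nu>X \<Phi> f) \<ge> \<rho> * ereal (dirichlet \<nu>X \<Gamma> f)"
    using le2 rho_le by blast
  have b: "2 * Gap \<nu>X \<Gamma> \<ge> Gap \<nu>X \<Phi> \<and> Gap \<nu>X \<Phi> \<ge> \<rho> * Gap \<nu>X \<Gamma>"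
    using Gap_mono_mult[of 2 \<nu>X \<Phi> \<Gamma>] Gap_ge_mult[OF rho0, of \<nu>X \<Gamma> \<Phi>] le2 rho_le by simp
  have upper: "asym_var \<nu>X \<Phi> f \<le> (inverse \<rho> - 1) * ereal (var_wrt \<nu>X f) + inverse \<rho> * asym_var \<nu>X \<Gamma> f"
    if f: "f \<in> L2 \<nu>X" and r: "0 < \<rho> \<and> \<rho> < \<infinity>" for f
  proof -
    obtain r where r: "\<rho> = ereal r" "0 < r" using r by (cases \<rho>) auto
    have "dirichlet \<nu>X \<Gamma> g \<le> inverse r * dirichlet \<nu>X \<Phi> g" if "g \<in> L2 \<nu>X" for g
      using rho_le[OF that] r by (simp add: field_simps)
    from asym_var_compare[OF Gam Phi f this] r
    have cmp: "asym_var \<nu>X \<Phi> f + ereal (var_wrt \<nu>X f) \<le> ereal (inverse r) * (asym_var \<nu>X \<Gamma> f + ereal (var_wrt \<nu>X f))"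
      by simp
    have inv: "inverse \<rho> - 1 = ereal (inverse r - 1)" "inverse \<rho> = ereal (inverse r)"
      using r by (simp_all add: one_ereal_def)
    show ?thesis
    proof (cases "asym_var \<nu>X \<Gamma> f")
      case (real g)
      then have "asym_var \<nu>X \<Phi> f + ereal (var_wrt \<nu>X f) \<le> ereal (inverse r * (g + var_wrt \<nu>X f))"
        using cmp by simp
      then have "asym_var \<nu>X \<Phi> f \<le> ereal (inverse r * (g + var_wrt \<nu>X f) - var_wrt \<nu>X f)"
        by (cases "asym_var \<nu>X \<Phi> f") auto
      also have "inverse r * (g + var_wrt \<nu>X f) - var_wrt \<nu>X f = (inverse r - 1) * var_wrt \<nu>X f + inverse r * g"
        by (simp add: algebra_simps)
      also have "ereal \<dots> = (inverse \<rho> - 1) * ereal (var_wrt \<nu>X f) + inverse \<rho> * asym_var \<nu>X \<Gamma> f"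
        unfolding inv(1) unfolding inv(2) real by (simp only: times_ereal.simps plus_ereal.simps)
      finally show ?thesis .
    next
      case PInf
      then show ?thesis unfolding inv using r by simp
    next
      case MInf
      then show ?thesis using G.asym_var_nonneg[OF f] by simp
    qed
  qed
  have lower: "(asym_var \<nu>X \<Gamma> f - ereal ((c - 1) * var_wrt \<nu>X f)) / ereal c \<le> asym_var \<nu>X \<Phi> f"
    if f: "f \<in> L2 \<nu>X" and c: "0 < c"
      and fibre: "\<And>g \<theta>. \<theta> \<in> space T \<Longrightarrow> g \<in> L2 (\<pi>T \<theta>) \<Longrightarrow> dirichlet (\<pi>T \<theta>) (P \<theta>) g \<le> c * var_wrt (\<pi>T \<theta>) g"
    for f c
  proof -
    have "asym_var \<nu>X \<Gamma> f + ereal (var_wrt \<nu>X f) \<le> ereal c * (asym_var \<nu>X \<Phi> f + ereal (var_wrt \<nu>X f))"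
      using c fibre by (intro asym_var_compare[OF Phi Gam f] le) auto
    note cmp = this
    have "asym_var \<nu>X \<Gamma> f - ereal ((c - 1) * var_wrt \<nu>X f) \<le> ereal c * asym_var \<nu>X \<Phi> f"
    proof (cases "asym_var \<nu>X \<Phi> f")
      case (real p)
      then have "asym_var \<nu>X \<Gamma> f + ereal (var_wrt \<nu>X f) \<le> ereal (c * (p + var_wrt \<nu>X f))"
        using cmp by simp
      moreover have "c * (p + var_wrt \<nu>X f) = c * p + (c - 1) * var_wrt \<nu>X f + var_wrt \<nu>X f"
        by (simp add: algebra_simps)
      ultimately show ?thesis
        unfolding real by (cases "asym_var \<nu>X \<Gamma> f") simp_all
    next
      case PInf
      then show ?thesis using c by simp
    next
      case MInf
      then show ?thesis using F.asym_var_nonneg[OF f] by simp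
    qed
    then show ?thesis
      using c by (subst ereal_divide_le_pos) simp_all
  qed
  have lower2: "(asym_var \<nu>X \<Gamma> f - ereal (var_wrt \<nu>X f)) / 2 \<le> asym_var \<nu>X \<Phi> f" if "f \<in> L2 \<nu>X" for f
    using lower[OF that, of 2] reversible_kernel.dirichlet_le_two_var[OF S.fibre_reversible_kernel] by simp
  have nonneg: "0 \<le> (asym_var \<nu>X \<Gamma> f - ereal (var_wrt \<nu>X f)) / 2" if f: "f \<in> L2 \<nu>X" for f
    using G.var_le_asym_var[OF _ f] S.positive_kernel_gibbs
    by (cases "asym_var \<nu>X \<Gamma> f") (auto simp: nu \<Gamma>_def)
  have c: "\<forall>f\<in>L2 \<nu>X. 0 \<le> (asym_var \<nu>X \<Gamma> f - ereal (var_wrt \<nu>X f)) / 2 \<and>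
        (asym_var \<nu>X \<Gamma> f - ereal (var_wrt \<nu>X f)) / 2 \<le> asym_var \<nu>X \<Phi> f \<and>
        (0 < \<rho> \<and> \<rho> < \<infinity> \<longrightarrow> asym_var \<nu>X \<Phi> f \<le>
            (inverse \<rho> - 1) * ereal (var_wrt \<nu>X f) + inverse \<rho> * asym_var \<nu>X \<Gamma> f)"
    by (intro ballI conjI impI, erule nonneg, erule lower2, rule upper)
  have d1: "(asym_var \<nu>X \<Gamma> f - ereal ((1 - \<epsilon>) * var_wrt \<nu>X f)) / ereal (2 - \<epsilon>) \<le> asym_var \<nu>X \<Phi> f"
    if eps: "\<epsilon> > 0" and minor: "\<forall>\<theta>\<in>space T. \<forall>x\<in>space X. \<forall>B\<in>sets X. measure (P \<theta> x) B \<ge> \<epsilon> * measure (\<pi>T \<theta>) B"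
      and f: "f \<in> L2 \<nu>X" for \<epsilon> f
  proof -
    (* Total mass forces epsilon <= 1, so that 2 - epsilon is a positive divisor. *)
    have "space T \<noteq> {}" "space X \<noteq> {}"
      using prob_space.not_empty[OF S.prob_nuT] prob_space.not_empty[OF S.prob_nuX] by simp_all
    then obtain \<theta> x where tx: "\<theta> \<in> space T" "x \<in> space X" by blast
    interpret fibre: reversible_kernel "\<pi>T \<theta>" "P \<theta>" by (rule S.fibre_reversible_kernel[OF tx(1)])
    have sp: "space (\<pi>T \<theta>') = space X" if "\<theta>' \<in> space T" for \<theta>'
      using sets_eq_imp_space_eq[OF S.sets_piT[OF that]] .
    have "\<epsilon> * measure (\<pi>T \<theta>) (space X) \<le> measure (P \<theta> x) (space X)"
      using minor tx by blast
    then have "\<epsilon> \<le> 1"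
      using fibre.prob_space prob_space.prob_le_1[OF fibre.Kprob, of x "space X"] tx
      by (simp add: sp)
    then show ?thesis
      using lower[OF f, of "2 - \<epsilon>"] minor eps
        reversible_kernel.dirichlet_le_var_minorised[OF S.fibre_reversible_kernel, of _ \<epsilon>]
      by (simp add: sp S.sets_piT)
  qed
  have d2: "asym_var \<nu>X \<Gamma> f \<le> asym_var \<nu>X \<Phi> f"
    if "\<forall>\<theta>\<in>space T. positive_kernel (\<pi>T \<theta>) (P \<theta>)" "f \<in> L2 \<nu>X" for f
    using lower[OF that(2), of 1] that(1)
      reversible_kernel.dirichlet_le_var_positive[OF S.fibre_reversible_kernel]
    by (simp flip: one_ereal_def)
  show ?thesis
  proof (intro conjI)
    show "\<forall>\<epsilon>. \<epsilon> > 0 \<and> (\<forall>\<theta>\<in>space T. \<forall>x\<in>space X. \<forall>B\<in>sets X. measure (P \<theta> x) B \<ge> \<epsilon> * measure (\<pi>T \<theta>) B) \<longrightarrow>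
        (\<forall>f\<in>L2 \<nu>X. (asym_var \<nu>X \<Gamma> f - ereal ((1 - \<epsilon>) * var_wrt \<nu>X f)) / ereal (2 - \<epsilon>) \<le> asym_var \<nu>X \<Phi> f)"
      by (intro allI impI ballI, elim conjE, rule d1)
    show "(\<forall>\<theta>\<in>space T. positive_kernel (\<pi>T \<theta>) (P \<theta>)) \<longrightarrow> (\<forall>f\<in>L2 \<nu>X. asym_var \<nu>X \<Gamma> f \<le> asym_var \<nu>X \<Phi> f)"
      by (intro impI ballI, rule d2)
  qed (fact a, rule b[THEN conjunct1], rule b[THEN conjunct2], fact c)
qed

end
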